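(* Let $f,g\in\mathcal C^2(\mathbb R)$ and $\underline u\in\mathbb R$ be such that $g(\underline u)=0$ and $g'(\underline u)<0$. Then for any $C_0>1$ there exists $\epsilon>0$ such that for any $v_0\in BUC^1(\mathbb R)$ satisfying $$\|v_0\|_{W^{1,\infty}(\mathbb R)}\le\epsilon,$$ the initial data $u|_{t=0}=\underline u+v_0$ generates a global unique classical solution $u\in BUC^1([0,\infty)\times\mathbb R)$ to $\partial_tu+\partial_x(f(u))=g(u)$, and it satisfies for any $t\ge0$ $$\|u(t,\cdot)-\underline u\|_{L^\infty(\mathbb R)}\le\|v_0\|_{L^\infty(\mathbb R)}\,C_0\,e^{g'(\underline u)t},\qquad \|\partial_xu(t,\cdot)\|_{L^\infty(\mathbb R)}\le\|\partial_xv_0\|_{L^\infty(\mathbb R)}\,C_0\,e^{g'(\underline u)t}.$$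
   Context: $BUC^k$ denotes the set of $\mathcal C^k$ functions whose derivatives up to order $k$ are bounded and uniformly continuous. *)

theory Defs
  imports "HOL-Analysis.Analysis" "HOL-Probability.Essential_Supremum"
begin

text \<open>
  Continuously differentiable functions, and functions with bounded uniformly continuous
  derivatives up to order \<open>k\<close>, on a set \<open>S\<close>. Derivatives are taken within \<open>S\<close>, hence are one-sided at
  boundary points (in the time direction at \<open>t = 0\<close>, for \<open>S = {0..} \<times> UNIV\<close>). The derivative \<open>D x\<close> is
  only meaningful where it is unique; this holds for the convex sets with nonempty interior used
  below. Its components along \<open>Basis\<close> are the partial derivatives.
\<close>

primrec C_diff :: "nat \<Rightarrow> 'a::euclidean_space set \<Rightarrow> ('a \<Rightarrow> real) set" where
  "C_diff 0 S = {f. continuous_on S f}"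
| "C_diff (Suc k) S =
     {f. \<exists>D. (\<forall>x\<in>S. (f has_derivative D x) (at x within S)) \<and>
             (\<forall>b\<in>Basis. (\<lambda>x. D x b) \<in> C_diff k S)}"

primrec BUC :: "nat \<Rightarrow> 'a::euclidean_space set \<Rightarrow> ('a \<Rightarrow> real) set" where
  "BUC 0 S = {f. bounded (f ` S) \<and> uniformly_continuous_on S f}"
| "BUC (Suc k) S =
     {f. bounded (f ` S) \<and> uniformly_continuous_on S f \<and>
         (\<exists>D. (\<forall>x\<in>S. (f has_derivative D x) (at x within S)) \<and>
              (\<forall>b\<in>Basis. (\<lambda>x. D x b) \<in> BUC k S))}"

lemma BUC_subset_C_diff: "BUC k S \<subseteq> C_diff k S"
proof (induction k)
  case 0
  then show ?case by (auto intro: uniformly_continuous_imp_continuous)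
next
  case (Suc k)
  then show ?case by fastforce
qed

lemma has_derivative_real_iff_deriv:
  fixes f :: "real \<Rightarrow> real"
  shows "(f has_derivative D) (at x) \<longleftrightarrow> f differentiable at x \<and> D = (*) (deriv f x)"
  by (metis DERIV_imp_deriv DERIV_deriv_iff_real_differentiable differentiable_def
      has_derivative_unique has_field_derivative_def)

lemma C_diff_Suc_real:
  fixes f :: "real \<Rightarrow> real"
  shows "f \<in> C_diff (Suc k) UNIV \<longleftrightarrow> (\<forall>x. f differentiable at x) \<and> deriv f \<in> C_diff k UNIV"
  by (auto simp: has_derivative_real_iff_deriv intro!: exI[of _ "\<lambda>x. (*) (deriv f x)"])

lemma BUC_Suc_real:
  fixes f :: "real \<Rightarrow> real"
  shows "f \<in> BUC (Suc k) UNIV \<longleftrightarrow>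
    bounded (range f) \<and> uniformly_continuous_on UNIV f \<and>
    (\<forall>x. f differentiable at x) \<and> deriv f \<in> BUC k UNIV"
  by (auto simp: has_derivative_real_iff_deriv intro!: exI[of _ "\<lambda>x. (*) (deriv f x)"])

definition Linfty_norm :: "(real \<Rightarrow> real) \<Rightarrow> ereal" where
  "Linfty_norm v = esssup lborel (\<lambda>x. ereal \<bar>v x\<bar>)"

text \<open>Only meant for continuously differentiable \<open>v\<close>, whose weak derivative is \<open>deriv v\<close>.\<close>

definition W1infty_norm :: "(real \<Rightarrow> real) \<Rightarrow> ereal" where
  "W1infty_norm v = max (Linfty_norm v) (Linfty_norm (deriv v))"

text \<open>
  Global classical solutions of \<open>\<partial>\<^sub>t u + \<partial>\<^sub>x (f(u)) = g(u)\<close> with initial data \<open>u0\<close>; the argument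
  of \<open>u\<close> is the pair \<open>(t, x)\<close>, and the values of \<open>u\<close> at negative times are irrelevant.
\<close>

definition classical_solution ::
    "(real \<Rightarrow> real) \<Rightarrow> (real \<Rightarrow> real) \<Rightarrow> (real \<Rightarrow> real) \<Rightarrow> (real \<times> real \<Rightarrow> real) \<Rightarrow> bool" where
  "classical_solution f g u0 u \<longleftrightarrow>
     u \<in> C_diff 1 ({0..} \<times> UNIV) \<and>
     (\<forall>x. u (0, x) = u0 x) \<and>
     (\<forall>t\<ge>0. \<forall>x. \<exists>a b.
        ((\<lambda>s. u (s, x)) has_real_derivative a) (at t within {0..}) \<and>
        ((\<lambda>y. f (u (t, y))) has_real_derivative b) (at x) \<and>
        a + b = g (u (t, x)))"

end

theory Submission
  imports Defs
begin

text \<open>Why the statement holds. Write \<open>r = - g'(ubar) > 0\<close>. Near the equilibrium the scalar field \<open>g\<close> is conjugate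
  to its linearization: a change of unknown \<open>z = H(u - ubar)\<close> with \<open>H' (0) = 1\<close> turns \<open>u' = g(u)\<close> into
  \<open>z' = - r z\<close> (\<open>linearizing_coordinate\<close>). Since a change of unknown preserves the transport structure, the
  balance law becomes \<open>\<partial>\<^sub>t z + a(z) \<partial>\<^sub>x z = - r z\<close>. Along its characteristics \<open>z\<close> decays exactly like
  \<open>exp (- r t)\<close>, and the position of a characteristic is an explicit function of time and starting point
  (\<open>characteristic_foot\<close>), in which the nonlinearity contributes only a bounded displacement. If the data
  and their derivative are small, the derivative of this displacement with respect to the starting
  point is small uniformly in time, so characteristics never cross; following them backwards
  gives a global solution. Uniform continuity of its derivatives is inherited
  from the data, because the feet of the characteristics depend on \<open>(t, x)\<close> in a Lipschitz way.

  The constants \<open>C0\<close> in the two estimates account for the slopes of \<open>H\<close>, of its inverse, and of the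
  characteristic map, all close to \<open>1\<close> for small data (\<open>global_decaying_solution\<close>).

  Uniqueness holds in the class of all classical solutions, bounded or not
  (\<open>classical_solution_unique\<close>). The difference of two solutions satisfies a linear transport inequality, to
  which a maximum principle in backward cones applies; a continuity argument in time shows that the
  second solution never leaves the range of values for which the slope of the cone was chosen.\<close>

section \<open>Essential suprema of continuous functions\<close>

text \<open>A nonempty open set has positive Lebesgue measure. If a continuous function exceeded its
  essential supremum at one point, it would do so on a neighbourhood of that point; hence essential
  bounds are pointwise bounds.\<close>

lemma abs_le_Linfty_norm:
  assumes v: "continuous_on UNIV v"
  shows "ereal \<bar>v x\<bar> \<le> Linfty_norm v"
proof (rule ccontr)
  assume "\<not> ereal \<bar>v x\<bar> \<le> Linfty_norm v"
  then have less: "Linfty_norm v < ereal \<bar>v x\<bar>" by simp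
  then obtain c where c: "Linfty_norm v < ereal c" "c < \<bar>v x\<bar>"
    using ereal_dense2 by force
  let ?U = "{y. c < \<bar>v y\<bar>}"
  have opn: "open ?U"
    using v by (intro open_Collect_less continuous_intros) auto
  have "AE y in lborel. ereal \<bar>v y\<bar> \<le> Linfty_norm v"
    unfolding Linfty_norm_def by (rule esssup_AE)
  then have "AE y in lborel. \<not> c < \<bar>v y\<bar>"
    proof eventually_elim
    fix y assume "ereal \<bar>v y\<bar> \<le> Linfty_norm v"
    then have "ereal \<bar>v y\<bar> < ereal c" using c(1) by (rule le_less_trans)
    then show "\<not> c < \<bar>v y\<bar>" by simp
  qed
  then have "?U \<in> null_sets lborel"
    using opn by (subst (asm) AE_iff_null) (auto intro: borel_open)
  then have "negligible ?U"
    using negligible_iff_null_sets null_sets_completionI by blast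
  then show False
    using open_not_negligible[OF opn] c(2) by blast
qed

lemma Linfty_norm_le:
  assumes "continuous_on UNIV v" and "\<And>x. \<bar>v x\<bar> \<le> c"
  shows "Linfty_norm v \<le> ereal c"
  unfolding Linfty_norm_def
proof (rule esssup_I)
  show "(\<lambda>x. ereal \<bar>v x\<bar>) \<in> borel_measurable lborel"
    using borel_measurable_continuous_onI[OF assms(1)] by measurable
qed (use assms(2) in auto)

lemma Linfty_norm_real:
  assumes v: "continuous_on UNIV v" and le: "Linfty_norm v \<le> ereal c"
  obtains m where "Linfty_norm v = ereal m" "0 \<le> m" "m \<le> c" "\<And>x. \<bar>v x\<bar> \<le> m"
proof -
  have ge: "ereal \<bar>v x\<bar> \<le> Linfty_norm v" for x
    by (rule abs_le_Linfty_norm[OF v])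
  then have "0 \<le> Linfty_norm v"
    by (metis abs_ge_zero ereal_less_eq(5) order_trans)
  with le obtain m where m: "Linfty_norm v = ereal m"
    by (cases "Linfty_norm v") auto
  show thesis
    by (rule that[of m]) (use m le ge \<open>0 \<le> Linfty_norm v\<close> in auto)
qed

section \<open>Bounded uniformly continuous functions\<close>

lemma BUC_0_const: "(\<lambda>x. c) \<in> BUC 0 S"
  by (simp add: uniformly_continuous_on_const image_constant_conv)

lemma BUC_0_add:
  assumes "u \<in> BUC 0 S" "v \<in> BUC 0 S"
  shows "(\<lambda>x. u x + v x) \<in> BUC 0 S"
proof -
  have "uniformly_continuous_on S (\<lambda>x. u x + v x)"
    by (rule uniformly_continuous_on_add) (use assms in simp_all)
  moreover have "bounded ((\<lambda>x. u x + v x) ` S)"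
    by (rule bounded_plus_comp) (use assms in simp_all)
  ultimately show ?thesis by simp
qed

text \<open>The range of a bounded function has compact closure, and there every continuous function is
  uniformly continuous.\<close>

lemma BUC_0_compose_continuous:
  fixes F :: "real \<Rightarrow> real"
  assumes u: "u \<in> BUC 0 S" and F: "continuous_on UNIV F"
  shows "(\<lambda>x. F (u x)) \<in> BUC 0 S"
proof -
  let ?K = "closure (u ` S)"
  have bd: "bounded (u ` S)" and uc: "uniformly_continuous_on S u" using u by simp_all
  have K: "compact ?K" using bd by (simp only: compact_closure)
  have F': "continuous_on ?K F" by (rule continuous_on_subset[OF F subset_UNIV])
  have "uniformly_continuous_on (u ` S) F"
    using compact_uniformly_continuous[OF F' K] closure_subset[of "u ` S"]
    unfolding uniformly_continuous_on_def by (meson subsetD)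
  then have "uniformly_continuous_on S (\<lambda>x. F (u x))"
    using uniformly_continuous_on_compose[OF uc] by blast
  moreover have "bounded ((\<lambda>x. F (u x)) ` S)"
    by (rule bounded_subset[OF compact_imp_bounded[OF compact_continuous_image[OF F' K]]])
      (use closure_subset[of "u ` S"] in auto)
  ultimately show ?thesis by simp
qed

text \<open>Polarisation reduces products to squares, which are covered by the composition rule.\<close>

lemma BUC_0_mult:
  assumes u: "u \<in> BUC 0 S" and v: "v \<in> BUC 0 S"
  shows "(\<lambda>x. u x * v x) \<in> BUC 0 S"
proof -
  have sq: "(\<lambda>x. c * (w x)\<^sup>2) \<in> BUC 0 S" if "w \<in> BUC 0 S" for w and c :: real
    by (rule BUC_0_compose_continuous[OF that]) (intro continuous_intros)
  have m: "(\<lambda>x. - v x) \<in> BUC 0 S"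
    by (rule BUC_0_compose_continuous[OF v]) (intro continuous_intros)
  have "(\<lambda>x. 1/4 * (u x + v x)\<^sup>2 + (-1/4) * (u x + - v x)\<^sup>2) \<in> BUC 0 S"
    by (rule BUC_0_add[OF sq[OF BUC_0_add[OF u v]] sq[OF BUC_0_add[OF u m]]])
  also have "(\<lambda>x. 1/4 * (u x + v x)\<^sup>2 + (-1/4) * (u x + - v x)\<^sup>2) = (\<lambda>x. u x * v x)"
    by (auto simp: power2_eq_square algebra_simps)
  finally show ?thesis .
qed

lemma BUC_0_reparam:
  assumes v: "v \<in> BUC 0 T" and p: "uniformly_continuous_on S p" "p ` S \<subseteq> T"
  shows "(\<lambda>x. v (p x)) \<in> BUC 0 S"
proof -
  have "uniformly_continuous_on (p ` S) v"
    using v p(2) unfolding BUC.simps uniformly_continuous_on_def mem_Collect_eq by (meson subsetD)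
  then have "uniformly_continuous_on S (\<lambda>x. v (p x))"
    using uniformly_continuous_on_compose[OF p(1)] by simp
  moreover have "bounded ((\<lambda>x. v (p x)) ` S)"
    by (rule bounded_subset[of "v ` T"]) (use v p(2) in auto)
  ultimately show ?thesis by simp
qed

lemma BUC_0_diff:
  assumes u: "u \<in> BUC 0 S" and v: "v \<in> BUC 0 S"
  shows "(\<lambda>x. u x - v x) \<in> BUC 0 S"
  using BUC_0_add[OF u BUC_0_mult[OF BUC_0_const[of "-1"] v]] by simp

lemma BUC_0_cong:
  assumes "\<And>x. x \<in> S \<Longrightarrow> u x = v x" and v: "v \<in> BUC 0 S"
  shows "u \<in> BUC 0 S"
proof -
  have "u ` S = v ` S" using assms(1) by (auto simp: image_iff)
  moreover have "uniformly_continuous_on S v \<longleftrightarrow> uniformly_continuous_on S u"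
    unfolding uniformly_continuous_on_def using assms(1) by simp
  ultimately show ?thesis using v by simp
qed

lemma BUC_0_exp_decay:
  fixes r :: real
  assumes r: "0 < r"
  shows "(\<lambda>p. exp (- r * fst p)) \<in> BUC 0 ({0..} \<times> (UNIV :: real set))"
proof -
  have "norm (exp (- r * s) - exp (- r * t)) \<le> r * norm (s - t)" if "s \<in> {0..}" "t \<in> {0..}" for s t
  proof (rule field_differentiable_bound[where S = "{0..}" and f' = "\<lambda>t. - r * exp (- r * t)"])
    show "((\<lambda>t. exp (- r * t)) has_real_derivative - r * exp (- r * t)) (at t within {0..})" for t
      by (auto intro!: derivative_eq_intros)
    show "norm (- r * exp (- r * t)) \<le> r" if "t \<in> {0..}" for t
      using that r by (simp add: abs_mult)
  qed (use that in auto)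
  then have "r-lipschitz_on {0..} (\<lambda>t. exp (- r * t))"
    by (intro lipschitz_onI) (use r in \<open>auto simp: dist_norm\<close>)
  then have "uniformly_continuous_on {0..} (\<lambda>t. exp (- r * t))"
    by (rule lipschitz_on_uniformly_continuous)
  moreover have "bounded ((\<lambda>t. exp (- r * t)) ` {0..})"
    unfolding bounded_iff by (rule exI[of _ 1]) (use r in auto)
  ultimately have "(\<lambda>t. exp (- r * t)) \<in> BUC 0 {0..}" by simp
  then show ?thesis
    by (rule BUC_0_reparam) (auto intro: bounded_linear.uniformly_continuous_on bounded_linear_fst
        uniformly_continuous_on_id)
qed

text \<open>On a convex set bounded partial derivatives make the function Lipschitz, so its uniform
  continuity need not be checked separately.\<close>

lemma BUC_1_I:
  fixes u :: "'a::euclidean_space \<Rightarrow> real"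
  assumes S: "convex S" and bd: "bounded (u ` S)"
    and D: "\<And>x. x \<in> S \<Longrightarrow> (u has_derivative D x) (at x within S)"
    and part: "\<And>b. b \<in> Basis \<Longrightarrow> (\<lambda>x. D x b) \<in> BUC 0 S"
  shows "u \<in> BUC 1 S"
proof -
  have "\<forall>b\<in>Basis. \<exists>C. \<forall>x\<in>S. \<bar>D x b\<bar> \<le> C"
    using part by (auto simp: bounded_iff)
  then obtain C where C: "\<And>b x. b \<in> Basis \<Longrightarrow> x \<in> S \<Longrightarrow> \<bar>D x b\<bar> \<le> C b"
    by metis
  have "onorm (D x) \<le> (\<Sum>b\<in>Basis. C b)" if x: "x \<in> S" for x
  proof (rule onorm_bound)
    show "0 \<le> (\<Sum>b\<in>Basis. C b)"
      by (rule sum_nonneg) (use C[OF _ x] in force)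
    fix h
    have lin: "linear (D x)"
      using D[OF x] has_derivative_linear by blast
    have "D x h = D x (\<Sum>b\<in>Basis. (h \<bullet> b) *\<^sub>R b)"
      by (simp add: euclidean_representation)
    also have "\<dots> = (\<Sum>b\<in>Basis. (h \<bullet> b) * D x b)"
      by (simp add: linear_sum[OF lin] linear_scale[OF lin])
    finally have "norm (D x h) \<le> (\<Sum>b\<in>Basis. \<bar>(h \<bullet> b) * D x b\<bar>)"
      by (simp add: sum_abs)
    also have "\<dots> \<le> (\<Sum>b\<in>Basis. C b * norm h)"
    proof (rule sum_mono)
      fix b :: 'a assume b: "b \<in> Basis"
      have "\<bar>h \<bullet> b\<bar> * \<bar>D x b\<bar> \<le> norm h * C b"
        by (rule mult_mono) (use C[OF b x] Basis_le_norm[OF b] in auto)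
      then show "\<bar>(h \<bullet> b) * D x b\<bar> \<le> C b * norm h" by (simp add: abs_mult mult.commute)
    qed
    finally show "norm (D x h) \<le> (\<Sum>b\<in>Basis. C b) * norm h"
      by (simp add: sum_distrib_right)
  qed
  then have lip: "norm (u x - u y) \<le> (\<Sum>b\<in>Basis. C b) * norm (x - y)" if "x \<in> S" "y \<in> S" for x y
    using differentiable_bound[OF S D] that by blast
  have "(\<Sum>b\<in>Basis. \<bar>C b\<bar>)-lipschitz_on S u"
  proof (rule lipschitz_onI)
    fix x y assume xy: "x \<in> S" "y \<in> S"
    have "norm (u x - u y) \<le> (\<Sum>b\<in>Basis. C b) * norm (x - y)" by (rule lip[OF xy])
    also have "\<dots> \<le> (\<Sum>b\<in>Basis. \<bar>C b\<bar>) * norm (x - y)"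
      by (intro mult_right_mono sum_mono) auto
    finally show "dist (u x) (u y) \<le> (\<Sum>b\<in>Basis. \<bar>C b\<bar>) * dist x y"
      by (simp add: dist_norm)
  qed (simp add: sum_nonneg)
  then have "uniformly_continuous_on S u"
    by (rule lipschitz_on_uniformly_continuous)
  then show ?thesis
    using bd D part by auto
qed

section \<open>Functions of one real variable\<close>

lemma antiderivative_real_line:
  fixes k :: "real \<Rightarrow> real"
  assumes "continuous_on UNIV k"
  obtains K where "K 0 = 0" "\<And>x. (K has_real_derivative k x) (at x)"
proof -
  have "\<exists>F. \<forall>x::real. -\<infinity> < ereal x \<longrightarrow> ereal x < \<infinity> \<longrightarrow> (F has_vector_derivative k x) (at x)"
    by (rule einterval_antiderivative)
      (use assms in \<open>auto simp: continuous_on_eq_continuous_at\<close>)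
  then obtain F where F: "\<And>x. (F has_real_derivative k x) (at x)"
    by (auto simp: has_real_derivative_iff_has_vector_derivative)
  show thesis
    by (rule that[of "\<lambda>x. F x - F 0"]) (auto intro!: derivative_eq_intros F)
qed

lemma continuous_bounded_on_interval:
  fixes k :: "real \<Rightarrow> real"
  assumes "continuous_on UNIV k"
  obtains C where "0 < C" "\<And>z. \<bar>z\<bar> \<le> d \<Longrightarrow> \<bar>k z\<bar> \<le> C"
proof -
  have "bounded (k ` {-d..d})"
    by (intro compact_imp_bounded compact_continuous_image continuous_on_subset[OF assms]) auto
  then obtain C where "0 < C" "\<forall>y \<in> k ` {-d..d}. norm y \<le> C"
    by (auto simp: bounded_pos)
  then show thesis by (intro that[of C]) (auto simp: abs_le_iff minus_le_iff)
qed

lemma C1_lipschitz_on_interval: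
  fixes k k' :: "real \<Rightarrow> real"
  assumes k: "\<And>x. (k has_real_derivative k' x) (at x)" and "continuous_on UNIV k'"
  obtains C where "0 < C" "\<And>x y. \<bar>x\<bar> \<le> d \<Longrightarrow> \<bar>y\<bar> \<le> d \<Longrightarrow> \<bar>k x - k y\<bar> \<le> C * \<bar>x - y\<bar>"
proof -
  obtain C where C: "0 < C" "\<And>z. \<bar>z\<bar> \<le> d \<Longrightarrow> \<bar>k' z\<bar> \<le> C"
    using continuous_bounded_on_interval[OF assms(2)] by blast
  have "\<bar>k x - k y\<bar> \<le> C * \<bar>x - y\<bar>" if "\<bar>x\<bar> \<le> d" "\<bar>y\<bar> \<le> d" for x y
    using field_differentiable_bound[of "{-d..d}" k k' C x y] C(2) k that
    by (auto simp: has_field_derivative_at_within abs_le_iff minus_le_iff)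
  then show thesis using C(1) that by blast
qed

lemma slope_lower_bound:
  fixes F :: "real \<Rightarrow> real"
  assumes F: "\<And>x. (F has_real_derivative F' x) (at x)" and m: "\<And>x. m \<le> F' x"
    and xy: "x \<le> y"
  shows "m * (y - x) \<le> F y - F x"
proof (cases "x < y")
  case True
  then obtain z where "F y - F x = (y - x) * F' z"
    using MVT2[of x y F F'] F by auto
  then show ?thesis using m[of z] True by (simp add: mult.commute mult_left_mono)
qed (use xy in simp)

lemma expanding_of_slope:
  fixes F :: "real \<Rightarrow> real"
  assumes F: "\<And>x. (F has_real_derivative F' x) (at x)" and m: "\<And>x. m \<le> F' x"
  shows "m * \<bar>y - x\<bar> \<le> \<bar>F y - F x\<bar>"
  using slope_lower_bound[OF F m, of x y] slope_lower_bound[OF F m, of y x]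
  by (cases x y rule: linorder_cases) auto

text \<open>The function stretches distances by the factor \<open>m\<close>, which gives injectivity, and which forces
  every value \<open>z\<close> to be attained at distance at most \<open>\<bar>z - F 0\<bar> / m\<close> from the origin.\<close>

lemma bij_of_slope:
  fixes F :: "real \<Rightarrow> real"
  assumes F: "\<And>x. (F has_real_derivative F' x) (at x)" and m: "\<And>x. m \<le> F' x" and m0: "0 < m"
  shows "bij F"
proof (rule bijI)
  show "inj F"
  proof (rule injI)
    fix x y assume "F x = F y"
    then show "x = y" using expanding_of_slope[OF F m, of x y] m0
      by (simp add: mult_le_0_iff)
  qed
  show "surj F"
  proof (rule surjI)
    fix z
    define d where "d = \<bar>z - F 0\<bar> / m"
    have d: "0 \<le> d" "m * d = \<bar>z - F 0\<bar>" using m0 by (auto simp: d_def)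
    have "F (-d) \<le> z" "z \<le> F d"
      using slope_lower_bound[OF F m, of "-d" 0] slope_lower_bound[OF F m, of 0 d] d by auto
    moreover have "continuous_on {-d..d} F"
      using F by (meson DERIV_continuous_on has_field_derivative_at_within)
    ultimately obtain x where "F x = z"
      using IVT'[of F "-d" z d] d(1) by auto
    then show "F (SOME x. F x = z) = z" by (rule someI)
  qed
qed

section \<open>Linearization of the source term\<close>

lemma difference_quotient_continuous:
  fixes a a' :: "real \<Rightarrow> real"
  assumes a: "\<And>z. (a has_real_derivative a' z) (at z)" and r: "r \<noteq> 0"
  obtains b where "continuous_on UNIV b" "\<And>z. a z = a 0 + r * z * b z"
proof -
  define b where "b z = (if z = 0 then a' 0 / r else (a z - a 0) / (r * z))" for z
  have cont_a: "isCont a z" for z using a DERIV_isCont by blast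
  have "isCont b z" for z
  proof (cases "z = 0")
    case True
    have "((\<lambda>z. (a z - a 0) / z) \<longlongrightarrow> a' 0) (at 0)"
      using a[of 0] by (simp add: has_field_derivative_iff)
    then have "((\<lambda>z. (a z - a 0) / z / r) \<longlongrightarrow> a' 0 / r) (at 0)"
      by (intro tendsto_intros r)
    then have "(b \<longlongrightarrow> a' 0 / r) (at 0)"
      by (rule Lim_transform_eventually)
        (auto simp: b_def eventually_at_filter field_simps)
    then show ?thesis by (simp add: True isCont_def b_def)
  next
    case False
    have "\<forall>\<^sub>F y in nhds z. y \<noteq> 0"
      using False by (rule t1_space_nhds)
    then have "\<forall>\<^sub>F y in nhds z. b y = (a y - a 0) / (r * y)"
      by eventually_elim (simp add: b_def)
    moreover have "isCont (\<lambda>y. (a y - a 0) / (r * y)) z"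
      by (intro continuous_intros cont_a) (use False r in auto)
    ultimately show ?thesis
      by (simp add: isCont_cong)
  qed
  then have "continuous_on UNIV b" by (simp add: continuous_on_eq_continuous_at)
  moreover have "a z = a 0 + r * z * b z" for z
    using r by (simp add: b_def)
  ultimately show thesis by (rule that)
qed

lemma second_order_remainder:
  fixes G G' :: "real \<Rightarrow> real"
  assumes G: "\<And>v. (G has_real_derivative G' v) (at v)" and G': "(G' has_real_derivative c) (at 0)"
    and G0: "G 0 = 0"
  obtains q where "continuous_on UNIV q" "\<And>v. G v = G' 0 * v + v\<^sup>2 * q v"
proof -
  define q where "q v = (if v = 0 then c / 2 else (G v - G' 0 * v) / v\<^sup>2)" for v
  have cont_G: "isCont G z" for z using G DERIV_isCont by blast
  have "isCont q z" for z
  proof (cases "z = 0")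
    case True
    have nz: "\<forall>\<^sub>F v::real in at 0. v \<noteq> 0" by (simp add: eventually_at_filter)
    have "((\<lambda>v. (G v - G' 0 * v) / v\<^sup>2) \<longlongrightarrow> c / 2) (at 0)"
    proof (rule lhopital[where f' = "\<lambda>v. G' v - G' 0" and g' = "\<lambda>v. 2 * v"])
      have "isCont (\<lambda>v. G v - G' 0 * v) 0" by (intro continuous_intros cont_G)
      then show "((\<lambda>v. G v - G' 0 * v) \<longlongrightarrow> 0) (at 0)" by (simp add: isCont_def G0)
      have "isCont (\<lambda>v::real. v\<^sup>2) 0" by (intro continuous_intros)
      then show "((\<lambda>v::real. v\<^sup>2) \<longlongrightarrow> 0) (at 0)" by (simp add: isCont_def)
      show "\<forall>\<^sub>F v::real in at 0. v\<^sup>2 \<noteq> 0" using nz by eventually_elim simp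
      show "\<forall>\<^sub>F v::real in at 0. 2 * v \<noteq> 0" using nz by eventually_elim simp
      show "\<forall>\<^sub>F v in at 0. ((\<lambda>v. G v - G' 0 * v) has_real_derivative G' v - G' 0) (at v)"
        by (auto intro!: always_eventually derivative_eq_intros G)
      show "\<forall>\<^sub>F v in at 0. ((\<lambda>v::real. v\<^sup>2) has_real_derivative 2 * v) (at v)"
        by (auto intro!: always_eventually derivative_eq_intros)
      have "((\<lambda>v. (G' v - G' 0) / v) \<longlongrightarrow> c) (at 0)"
        using G' by (simp add: has_field_derivative_iff)
      then have "((\<lambda>v. (G' v - G' 0) / v / 2) \<longlongrightarrow> c / 2) (at 0)"
        by (intro tendsto_intros) auto
      then show "((\<lambda>v. (G' v - G' 0) / (2 * v)) \<longlongrightarrow> c / 2) (at 0)"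
        by (simp add: mult.commute)
    qed
    then have "(q \<longlongrightarrow> c / 2) (at 0)"
      by (rule Lim_transform_eventually) (auto simp: q_def eventually_at_filter)
    then show ?thesis by (simp add: True isCont_def q_def)
  next
    case False
    have "\<forall>\<^sub>F y in nhds z. y \<noteq> 0"
      using False by (rule t1_space_nhds)
    then have "\<forall>\<^sub>F y in nhds z. q y = (G y - G' 0 * y) / y\<^sup>2"
      by eventually_elim (simp add: q_def)
    moreover have "isCont (\<lambda>y. (G y - G' 0 * y) / y\<^sup>2) z"
      by (intro continuous_intros cont_G) (use False in auto)
    ultimately show ?thesis
      by (simp add: isCont_cong)
  qed
  then have "continuous_on UNIV q" by (simp add: continuous_on_eq_continuous_at)
  moreover have "G v = G' 0 * v + v\<^sup>2 * q v" for v
    using G0 by (simp add: q_def)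
  ultimately show thesis by (rule that)
qed

text \<open>Replacing the argument \<open>v\<close> by \<open>clamp_to d v\<close> extends a function from \<open>[-d, d]\<close> to the line by
  constants, keeping continuity and all bounds. This turns local objects into global ones, so that
  domains of definition need not be tracked.\<close>

definition clamp_to :: "real \<Rightarrow> real \<Rightarrow> real" where
  "clamp_to d v = max (- d) (min d v)"

lemma clamp_to_id: "\<bar>v\<bar> \<le> d \<Longrightarrow> clamp_to d v = v"
  by (auto simp: clamp_to_def)

lemma abs_clamp_to_le: "0 \<le> d \<Longrightarrow> \<bar>clamp_to d v\<bar> \<le> d"
  by (auto simp: clamp_to_def)

lemma continuous_on_clamp_to:
  assumes "continuous_on {-d..d} k" "0 \<le> d"
  shows "continuous_on UNIV (\<lambda>v. k (clamp_to d v))"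
  by (rule continuous_on_compose2[OF assms(1)])
    (use assms(2) in \<open>auto simp: clamp_to_def intro!: continuous_intros\<close>)

lemma close_near_0:
  fixes k :: "real \<Rightarrow> real"
  assumes "isCont k 0" "0 < e"
  obtains d where "0 < d" "\<And>v. \<bar>v\<bar> \<le> d \<Longrightarrow> \<bar>k v - k 0\<bar> < e"
proof -
  obtain d where d: "0 < d" "\<And>v. \<bar>v\<bar> < d \<Longrightarrow> \<bar>k v - k 0\<bar> < e"
    using assms by (auto simp: continuous_at_eps_delta dist_real_def)
  show thesis by (rule that[of "d/2"]) (use d in auto)
qed

text \<open>A coordinate \<open>z = H v\<close> in which the ordinary differential equation \<open>v' = G v\<close> becomes
  \<open>z' = - r z\<close> must satisfy \<open>H' G = - r H\<close>. The ansatz \<open>H v = v exp (K v)\<close> turns this into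
  \<open>K' v = - r / G v - 1 / v\<close>, where the two poles at \<open>0\<close> cancel: if \<open>G v = - r v + v\<^sup>2 q v\<close>, then
  \<open>K' v = q v / (r - v q v)\<close>, which is continuous near \<open>0\<close>. This is the place where two derivatives of
  \<open>G\<close> at \<open>0\<close> are used. Since \<open>H' 0 = 1\<close>, the slope is within \<open>\<eta>\<close> of \<open>1\<close> on a small interval; extending
  it by constants gives a coordinate on the whole line.\<close>

lemma linearizing_coordinate:
  fixes G G' :: "real \<Rightarrow> real"
  assumes G: "\<And>v. (G has_real_derivative G' v) (at v)" and G': "(G' has_real_derivative c) (at 0)"
    and G0: "G 0 = 0" and r: "G' 0 = - r" "0 < r" and \<eta>: "0 < \<eta>"
  obtains \<delta> H \<theta> where "0 < \<delta>" "\<And>v. (H has_real_derivative \<theta> v) (at v)" "continuous_on UNIV \<theta>"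
    "\<And>v. \<bar>\<theta> v - 1\<bar> \<le> \<eta>" "H 0 = 0" "\<And>v. \<bar>v\<bar> \<le> \<delta> \<Longrightarrow> G v * \<theta> v = - r * H v"
proof -
  obtain q where q: "continuous_on UNIV q" and Gq: "\<And>v. G v = - r * v + v\<^sup>2 * q v"
    using second_order_remainder[OF G G' G0] r(1) by metis
  have cont_q: "isCont q v" for v using q by (simp add: continuous_on_eq_continuous_at)
  have "isCont (\<lambda>v. v * q v) 0" by (intro continuous_intros cont_q)
  then obtain d where d: "0 < d" "\<And>v. \<bar>v\<bar> \<le> d \<Longrightarrow> \<bar>v * q v\<bar> < r"
    using close_near_0[of "\<lambda>v. v * q v" r] r(2) by auto
  define \<kappa> where "\<kappa> v = q v / (r - v * q v)" for v
  have pos: "0 < r - v * q v" if "\<bar>v\<bar> \<le> d" for v using d(2)[OF that] by auto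
  have "continuous_on {-d..d} \<kappa>"
    unfolding \<kappa>_def
    by (intro continuous_intros continuous_on_subset[OF q]) (use pos in force)+
  then have "continuous_on UNIV (\<lambda>v. \<kappa> (clamp_to d v))"
    using d(1) by (intro continuous_on_clamp_to) auto
  then obtain K where K0: "K 0 = 0" and K: "\<And>v. (K has_real_derivative \<kappa> (clamp_to d v)) (at v)"
    using antiderivative_real_line by blast
  have cont_K: "isCont K v" for v using K DERIV_isCont by blast
  \<comment> \<open>The slope of the ansatz, because \<open>1 + v * \<kappa> v = r / (r - v * q v)\<close>.\<close>
  define \<phi> where "\<phi> v = exp (K v) * (r / (r - v * q v))" for v
  have "isCont \<phi> 0"
    unfolding \<phi>_def by (intro continuous_intros cont_K cont_q) (use r(2) in auto)
  moreover have \<phi>0: "\<phi> 0 = 1" using K0 r(2) by (simp add: \<phi>_def)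
  ultimately obtain e where e: "0 < e" "\<And>v. \<bar>v\<bar> \<le> e \<Longrightarrow> \<bar>\<phi> v - 1\<bar> < \<eta>"
    using close_near_0[of \<phi> \<eta>] \<eta> by metis
  define \<delta> where "\<delta> = min d e"
  have \<delta>: "0 < \<delta>" "\<delta> \<le> d" "\<delta> \<le> e" using d e by (auto simp: \<delta>_def)
  have "continuous_on {-\<delta>..\<delta>} \<phi>"
    unfolding \<phi>_def
    by (intro continuous_intros continuous_on_subset[OF q] continuous_at_imp_continuous_on ballI cont_K)
      (use pos \<delta> in force)+
  then have \<theta>_cont: "continuous_on UNIV (\<lambda>v. \<phi> (clamp_to \<delta> v))"
    using \<delta>(1) by (intro continuous_on_clamp_to) auto
  then obtain H where H0: "H 0 = 0" and H: "\<And>v. (H has_real_derivative \<phi> (clamp_to \<delta> v)) (at v)"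
    using antiderivative_real_line by blast
  have H_eq: "H v = v * exp (K v)" if v: "\<bar>v\<bar> \<le> \<delta>" for v
  proof -
    have "((\<lambda>v. H v - v * exp (K v)) has_real_derivative 0) (at v within {-\<delta>..\<delta>})"
      if "v \<in> {-\<delta>..\<delta>}" for v
    proof -
      have v: "\<bar>v\<bar> \<le> \<delta>" "\<bar>v\<bar> \<le> d" using that \<delta> by auto
      have "((\<lambda>v. H v - v * exp (K v)) has_real_derivative
          \<phi> v - (exp (K v) + v * (exp (K v) * \<kappa> v))) (at v)"
        by (rule derivative_eq_intros H K refl)+ (simp add: clamp_to_id v)
      moreover have "exp (K v) + v * (exp (K v) * \<kappa> v) = \<phi> v"
        using pos[OF v(2)] by (simp add: \<phi>_def \<kappa>_def field_simps)
      ultimately show ?thesis by (simp add: has_field_derivative_at_within)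
    qed
    then obtain k where "\<And>v. v \<in> {-\<delta>..\<delta>} \<Longrightarrow> H v - v * exp (K v) = k"
      using has_field_derivative_zero_constant[of "{-\<delta>..\<delta>}" "\<lambda>v. H v - v * exp (K v)"] by auto
    from this[of v] this[of 0] show ?thesis using v \<delta>(1) H0 by (auto simp: abs_le_iff minus_le_iff)
  qed
  show thesis
  proof (rule that[OF \<delta>(1) H \<theta>_cont])
    show "\<bar>\<phi> (clamp_to \<delta> v) - 1\<bar> \<le> \<eta>" for v
      using e(2)[of "clamp_to \<delta> v"] abs_clamp_to_le[of \<delta> v] \<delta> by auto
    show "G v * \<phi> (clamp_to \<delta> v) = - r * H v" if v: "\<bar>v\<bar> \<le> \<delta>" for v
    proof -
      have "G v = - v * (r - v * q v)" by (simp add: Gq algebra_simps power2_eq_square)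
      then have "G v * \<phi> v = - r * (v * exp (K v))"
        using pos[of v] v \<delta>(2) by (simp add: \<phi>_def)
      then show ?thesis by (simp add: H_eq[OF v] clamp_to_id[OF v])
    qed
  qed (rule H0)
qed

text \<open>The way back from the linearizing coordinate. The lower bound \<open>m\<close> on the slope is all that enters
  the estimate, so passing to \<open>z\<close> and back costs little when the slope is close to \<open>1\<close>.\<close>

lemma linearizing_parametrization:
  fixes H \<theta> :: "real \<Rightarrow> real"
  assumes H: "\<And>v. (H has_real_derivative \<theta> v) (at v)" and \<theta>: "continuous_on UNIV \<theta>"
    and m: "\<And>v. m \<le> \<theta> v" "0 < m" and H0: "H 0 = 0"
  obtains h where "\<And>z. (h has_real_derivative inverse (\<theta> (h z))) (at z)"
    "continuous_on UNIV h" "\<And>z. H (h z) = z" "\<And>v. h (H v) = v" "\<And>z. \<bar>h z\<bar> \<le> \<bar>z\<bar> / m"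
proof -
  have bij: "bij H" by (rule bij_of_slope[OF H m])
  define h where "h = inv H"
  have Hh: "H (h z) = z" for z
    using bij by (simp add: h_def bij_is_surj surj_f_inv_f)
  have hH: "h (H v) = v" for v
    using bij by (simp add: h_def bij_is_inj)
  have exp: "m * \<bar>h z - h y\<bar> \<le> \<bar>z - y\<bar>" for y z
    using expanding_of_slope[OF H m(1), of "h z" "h y"] by (simp add: Hh)
  then have lip: "\<bar>h z - h y\<bar> \<le> (1 / m) * \<bar>z - y\<bar>" for y z
    using m(2) by (simp add: field_simps)
  have "(1/m)-lipschitz_on UNIV h"
    by (rule lipschitz_onI) (use lip m(2) in \<open>auto simp: dist_real_def\<close>)
  then have cont: "continuous_on UNIV h"
    by (rule lipschitz_on_continuous_on)
  have h0: "h 0 = 0" using hH[of 0] H0 by simp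
  have bd: "\<bar>h z\<bar> \<le> \<bar>z\<bar> / m" for z
    using lip[of z 0] by (simp add: h0)
  have der: "(h has_real_derivative inverse (\<theta> (h z))) (at z)" for z
  proof (rule DERIV_inverse_function[where f = H and a = "z - 1" and b = "z + 1"])
    show "\<theta> (h z) \<noteq> 0" using m(1)[of "h z"] m(2) by linarith
    show "isCont h z" using cont by (simp add: continuous_on_eq_continuous_at)
  qed (use H Hh in auto)
  show thesis by (rule that[OF der cont Hh hH bd])
qed

section \<open>Characteristics\<close>

text \<open>The equation \<open>\<partial>\<^sub>t z + a(z) \<partial>\<^sub>x z = - r z\<close> with \<open>a(z) = a0 + r z b(z)\<close> is solved explicitly. Along the
  characteristic issuing from \<open>y\<close> the solution is \<open>exp (- r t) z0(y)\<close>; integrating \<open>a\<close> in time with \<open>z\<close>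
  as the integration variable gives, for an antiderivative \<open>B\<close> of \<open>b\<close>, the position
  \<open>x = y + a0 t + B(z0(y)) - B(exp (- r t) z0(y))\<close>.
  Apart from the drift \<open>a0 t\<close>, time enters only through \<open>exp (- r t)\<close>, which stays in \<open>[0, 1]\<close>: this is
  why all bounds are uniform in time.

  The last hypothesis says that the derivative \<open>J\<close> of \<open>x\<close> with respect to \<open>y\<close> stays within \<open>\<eta>\<close> of \<open>1\<close>.
  Characteristics therefore never cross and cover the line at every time, and \<open>Y (t, x)\<close> is the point
  from which the one through \<open>(t, x)\<close> issues. Its differential is obtained by inverting
  \<open>(t, y) \<mapsto> (t, x)\<close> relative to the closed half-plane; it expresses \<open>\<partial>\<^sub>t Y + a(z) \<partial>\<^sub>x Y = 0\<close>.\<close>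

lemma characteristic_foot:
  fixes b B z0 z0' :: "real \<Rightarrow> real" and r a0 \<eta> :: real
  defines "S \<equiv> {0..} \<times> (UNIV :: real set)"
  defines "\<tau> \<equiv> \<lambda>p :: real \<times> real. exp (- r * fst p)"
  assumes r: "0 < r" and B: "\<And>z. (B has_real_derivative b z) (at z)" and b: "continuous_on UNIV b"
    and z0: "\<And>y. (z0 has_real_derivative z0' y) (at y)"
    and z0_BUC: "z0 \<in> BUC 0 UNIV" and z0'_BUC: "z0' \<in> BUC 0 UNIV"
    and \<eta>: "\<eta> < 1"
    and slope: "\<And>\<sigma> y. 0 \<le> \<sigma> \<Longrightarrow> \<sigma> \<le> 1 \<Longrightarrow> \<bar>z0' y * (b (z0 y) - \<sigma> * b (\<sigma> * z0 y))\<bar> \<le> \<eta>"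
  obtains Y J where "\<And>x. Y (0, x) = x" "uniformly_continuous_on S Y"
    "J \<in> BUC 0 S" "\<And>p. p \<in> S \<Longrightarrow> \<bar>J p - 1\<bar> \<le> \<eta>"
    "\<And>p. p \<in> S \<Longrightarrow> (Y has_derivative
        (\<lambda>q. (snd q - (a0 + r * (\<tau> p * z0 (Y p)) * b (\<tau> p * z0 (Y p))) * fst q) / J p)) (at p within S)"
proof -
  define m where "m = 1 - \<eta>"
  have m: "0 < m" using \<eta> by (simp add: m_def)
  have \<tau>: "0 \<le> \<tau> p" "\<tau> p \<le> 1" if "p \<in> S" for p
    using that r by (auto simp: \<tau>_def S_def)
  \<comment> \<open>Position at time \<open>t\<close> of the characteristic issuing from \<open>y\<close>, with partial derivatives \<open>A\<close> in \<open>t\<close> and \<open>J0\<close> in \<open>y\<close>.\<close>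
  define Q where "Q p = snd p + a0 * fst p + B (z0 (snd p)) - B (\<tau> p * z0 (snd p))" for p
  define A where "A p = a0 + r * (\<tau> p * z0 (snd p)) * b (\<tau> p * z0 (snd p))" for p
  define J0 where "J0 p = 1 + z0' (snd p) * (b (z0 (snd p)) - \<tau> p * b (\<tau> p * z0 (snd p)))" for p
  have J0: "\<bar>J0 p - 1\<bar> \<le> \<eta>" if "p \<in> S" for p
    using slope[OF \<tau>[OF that]] by (simp add: J0_def)
  have J0_pos: "m \<le> J0 p" if "p \<in> S" for p using J0[OF that] by (auto simp: m_def)
  have Bd: "((\<lambda>x. B (k x)) has_derivative (\<lambda>h. k' h * b (k p))) (at p within T)"
    if "(k has_derivative k') (at p within T)" for k k' T and p :: "real \<times> real"
    using DERIV_compose_FDERIV[OF B that] .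
  have zd: "((\<lambda>x. z0 (snd x)) has_derivative (\<lambda>h. snd h * z0' (snd p))) (at p within T)"
    for T and p :: "real \<times> real"
    by (rule DERIV_compose_FDERIV[OF z0]) (auto intro!: derivative_eq_intros)
  have Qd: "(Q has_derivative (\<lambda>q. J0 p * snd q + A p * fst q)) (at p within T)" for p T
    unfolding Q_def \<tau>_def
    by (rule derivative_eq_intros Bd zd refl)+
      (auto simp: J0_def A_def \<tau>_def fun_eq_iff algebra_simps)
  have Qy: "((\<lambda>y. Q (t, y)) has_real_derivative J0 (t, y)) (at y)" for t y
  proof -
    have "((\<lambda>y. (t, y)) has_derivative (\<lambda>h. (0, h))) (at y)"
      by (auto intro!: derivative_eq_intros)
    from has_derivative_compose[OF this Qd] show ?thesis
      by (simp add: has_field_derivative_def mult_commute_abs)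
  qed
  have Qt: "((\<lambda>t. Q (t, y)) has_real_derivative A (t, y)) (at t within T)" for t y T
  proof -
    have "((\<lambda>t. (t, y)) has_derivative (\<lambda>h. (h, 0))) (at t within T)"
      by (auto intro!: derivative_eq_intros)
    from has_derivative_compose[OF this Qd] show ?thesis
      by (simp add: has_field_derivative_def mult_commute_abs)
  qed
  have expanding: "m * \<bar>y - y'\<bar> \<le> \<bar>Q (t, y) - Q (t, y')\<bar>" if "0 \<le> t" for t y y'
    by (rule expanding_of_slope[OF Qy]) (use that J0_pos in \<open>auto simp: S_def\<close>)
  have bijQ: "bij (\<lambda>y. Q (t, y))" if "0 \<le> t" for t
    by (rule bij_of_slope[OF Qy _ m]) (use that J0_pos in \<open>auto simp: S_def\<close>)
  define Y where "Y p = inv (\<lambda>y. Q (fst p, y)) (snd p)" for p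
  have QY: "Q (fst p, Y p) = snd p" if "p \<in> S" for p
    using surj_f_inv_f[OF bij_is_surj[OF bijQ]] that by (auto simp: Y_def S_def)
  have YQ: "Y (t, Q (t, y)) = y" if "0 \<le> t" for t y
    using inv_f_f[OF bij_is_inj[OF bijQ[OF that]]] by (simp add: Y_def)
  have Y0: "Y (0, x) = x" for x
    using YQ[of 0 x] by (simp add: Q_def \<tau>_def)
  obtain Z where Z: "\<And>y. \<bar>z0 y\<bar> \<le> Z"
    using z0_BUC by (auto simp: bounded_iff)
  have "continuous_on UNIV (\<lambda>z. z * b z)" by (intro continuous_intros b)
  then obtain N where N: "0 < N" "\<And>z. \<bar>z\<bar> \<le> Z \<Longrightarrow> \<bar>z * b z\<bar> \<le> N"
    using continuous_bounded_on_interval by blast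
  have A: "\<bar>A p\<bar> \<le> \<bar>a0\<bar> + r * N" if "p \<in> S" for p
  proof -
    have "\<bar>\<tau> p\<bar> * \<bar>z0 (snd p)\<bar> \<le> 1 * Z"
      by (rule mult_mono) (use \<tau>[OF that] Z in auto)
    then have "\<bar>\<tau> p * z0 (snd p) * b (\<tau> p * z0 (snd p))\<bar> \<le> N"
      by (intro N(2)) (simp add: abs_mult)
    then have "\<bar>r * (\<tau> p * z0 (snd p) * b (\<tau> p * z0 (snd p)))\<bar> \<le> r * N"
      using r by (simp add: abs_mult)
    then show ?thesis unfolding A_def by (simp add: mult.assoc)
  qed
  define L where "L = \<bar>a0\<bar> + r * N"
  have L: "0 \<le> L" using r N(1) by (simp add: L_def)
  have Q_lip: "\<bar>Q (s, y) - Q (t, y)\<bar> \<le> L * \<bar>s - t\<bar>" if "0 \<le> s" "0 \<le> t" for s t y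
    using field_differentiable_bound[of "{0..}" "\<lambda>t. Q (t, y)" "\<lambda>t. A (t, y)" L s t, OF _ Qt]
      A that by (auto simp: L_def S_def)
  have "((1 + L) / m)-lipschitz_on S Y"
  proof (rule lipschitz_onI)
    fix p p' assume p: "p \<in> S" and p': "p' \<in> S"
    have "m * \<bar>Y p - Y p'\<bar> \<le> \<bar>Q (fst p, Y p) - Q (fst p, Y p')\<bar>"
      by (rule expanding) (use p in \<open>auto simp: S_def\<close>)
    also have "\<dots> \<le> \<bar>snd p - snd p'\<bar> + \<bar>Q (fst p', Y p') - Q (fst p, Y p')\<bar>"
      using QY[OF p] QY[OF p'] by auto
    also have "\<dots> \<le> \<bar>snd p - snd p'\<bar> + L * \<bar>fst p' - fst p\<bar>"
      using Q_lip[of "fst p'" "fst p" "Y p'"] p p' by (auto simp: S_def)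
    also have "\<dots> \<le> dist p p' + L * dist p p'"
      by (intro add_mono mult_left_mono L)
        (use dist_snd_le[of p p'] dist_fst_le[of p' p] in \<open>auto simp: dist_real_def dist_commute\<close>)
    finally show "dist (Y p) (Y p') \<le> (1 + L) / m * dist p p'"
      using m by (simp add: dist_real_def field_simps)
  qed (use L m in auto)
  then have Y_uc: "uniformly_continuous_on S Y"
    by (rule lipschitz_on_uniformly_continuous)
  define J where "J p = J0 (fst p, Y p)" for p
  have J: "\<bar>J p - 1\<bar> \<le> \<eta>" if "p \<in> S" for p
    unfolding J_def by (rule J0) (use that in \<open>auto simp: S_def\<close>)
  have J_BUC: "J \<in> BUC 0 S"
  proof -
    have \<tau>_BUC: "\<tau> \<in> BUC 0 S" using BUC_0_exp_decay[OF r] by (simp add: \<tau>_def S_def)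
    have Y1: "(\<lambda>p. z0 (Y p)) \<in> BUC 0 S" "(\<lambda>p. z0' (Y p)) \<in> BUC 0 S"
      by (rule BUC_0_reparam[OF _ Y_uc subset_UNIV], fact)+
    have "(\<lambda>p. 1 + z0' (Y p) * (b (z0 (Y p)) - \<tau> p * b (\<tau> p * z0 (Y p)))) \<in> BUC 0 S"
      by (rule BUC_0_add[OF BUC_0_const BUC_0_mult[OF Y1(2) BUC_0_diff[OF BUC_0_compose_continuous[OF Y1(1) b]
          BUC_0_mult[OF \<tau>_BUC BUC_0_compose_continuous[OF BUC_0_mult[OF \<tau>_BUC Y1(1)] b]]]]])
    then show ?thesis by (simp add: J_def[abs_def] J0_def \<tau>_def)
  qed
  have Yd: "(Y has_derivative (\<lambda>q. (snd q - A (fst p, Y p) * fst q) / J p)) (at p within S)"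
    if p: "p \<in> S" for p
  proof -
    define \<Psi> where "\<Psi> q = (fst q, Q q)" for q
    define a where "a = (fst p, Y p)"
    have aS: "a \<in> S" and \<Psi>a: "\<Psi> a = p"
      using p QY[OF p] by (auto simp: a_def S_def \<Psi>_def)
    have img: "\<Psi> ` S = S"
    proof
      show "\<Psi> ` S \<subseteq> S" by (auto simp: \<Psi>_def S_def)
      show "S \<subseteq> \<Psi> ` S"
      proof
        fix q assume q: "q \<in> S"
        then have "q = \<Psi> (fst q, Y q)" "(fst q, Y q) \<in> S"
          using QY[OF q] by (auto simp: \<Psi>_def S_def)
        then show "q \<in> \<Psi> ` S" by blast
      qed
    qed
    have Ja: "J0 a \<noteq> 0" using J0_pos[OF aS] m by linarith
    have "((\<lambda>q. (fst q, Y q)) has_derivative (\<lambda>q. (fst q, (snd q - A a * fst q) / J0 a)))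
        (at (\<Psi> a) within \<Psi> ` S)"
    proof (rule has_derivative_inverse_within)
      show "(\<Psi> has_derivative (\<lambda>q. (fst q, J0 a * snd q + A a * fst q))) (at a within S)"
        unfolding \<Psi>_def by (intro has_derivative_Pair Qd has_derivative_fst has_derivative_ident)
      have "continuous_on S Y" by (rule uniformly_continuous_imp_continuous[OF Y_uc])
      then have "continuous (at p within S) Y"
        using p by (simp add: continuous_on_eq_continuous_within)
      then show "continuous (at (\<Psi> a) within \<Psi> ` S) (\<lambda>q. (fst q, Y q))"
        unfolding \<Psi>a img by (intro continuous_intros)
      show "linear (\<lambda>q. (fst q, (snd q - A a * fst q) / J0 a))"
        by (rule linearI) (auto simp: diff_divide_distrib add_divide_distrib algebra_simps)
      show "(\<lambda>q. (fst q, (snd q - A a * fst q) / J0 a)) \<circ>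
          (\<lambda>q. (fst q, J0 a * snd q + A a * fst q)) = id"
        using Ja by (auto simp: fun_eq_iff)
      show "(fst (\<Psi> q), Y (\<Psi> q)) = q" if "q \<in> S" for q
        using that YQ by (auto simp: \<Psi>_def S_def)
    qed (rule aS)
    then have "((\<lambda>q. snd (fst q, Y q)) has_derivative
        (\<lambda>q. snd (fst q, (snd q - A a * fst q) / J0 a))) (at p within S)"
      unfolding \<Psi>a img by (rule has_derivative_snd)
    then show ?thesis by (simp add: a_def J_def)
  qed
  show thesis
  proof (rule that[OF Y0 Y_uc J_BUC J])
    fix p assume "p \<in> S"
    from Yd[OF this] show "(Y has_derivative
        (\<lambda>q. (snd q - (a0 + r * (\<tau> p * z0 (Y p)) * b (\<tau> p * z0 (Y p))) * fst q) / J p)) (at p within S)"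
      by (simp add: A_def \<tau>_def)
  qed
qed

section \<open>Global existence and decay\<close>

text \<open>In the linearizing coordinate \<open>z = H(u - ubar)\<close> the equation becomes
  \<open>\<partial>\<^sub>t z + a(z) \<partial>\<^sub>x z = - r z\<close> with \<open>a(z) = f'(ubar + h(z))\<close>, whose solution is
  \<open>exp (- r t) z0(Y(t, x))\<close> with \<open>Y\<close> the foot of the characteristic. The decay rate is thus exact. Its
  \<open>x\<close>-derivative is \<open>exp (- r t) z0'(Y) / J\<close>, so the constant \<open>C0\<close> only has to absorb the distortion by
  \<open>H\<close> and \<open>h\<close> and the factor \<open>1 / J\<close>, all of which tend to \<open>1\<close> as the data become small.\<close>

lemma global_decaying_solution:
  fixes f f' f'' g g' :: "real \<Rightarrow> real" and ubar r c C0 :: real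
  defines "S \<equiv> {0..} \<times> (UNIV :: real set)"
  assumes f: "\<And>v. (f has_real_derivative f' v) (at v)" and f': "\<And>v. (f' has_real_derivative f'' v) (at v)"
    and g: "\<And>v. (g has_real_derivative g' v) (at v)" and g': "(g' has_real_derivative c) (at ubar)"
    and g0: "g ubar = 0" and r: "g' ubar = - r" "0 < r" and C0: "1 < C0"
  shows "\<exists>\<epsilon>>0. \<forall>v0\<in>BUC 1 UNIV. \<forall>k k'. (\<forall>y. \<bar>v0 y\<bar> \<le> k) \<longrightarrow> (\<forall>y. \<bar>deriv v0 y\<bar> \<le> k') \<longrightarrow>
    k \<le> \<epsilon> \<longrightarrow> k' \<le> \<epsilon> \<longrightarrow>
    (\<exists>u ux. u \<in> BUC 1 S \<and> ux \<in> BUC 0 S \<and> classical_solution f g (\<lambda>x. ubar + v0 x) u \<and>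
      (\<forall>t\<ge>0. \<forall>x. ((\<lambda>y. u (t, y)) has_real_derivative ux (t, x)) (at x) \<and>
        \<bar>u (t, x) - ubar\<bar> \<le> k * (C0 * exp (- r * t)) \<and> \<bar>ux (t, x)\<bar> \<le> k' * (C0 * exp (- r * t))))"
proof -
  \<comment> \<open>The coordinate change costs \<open>1 + \<eta>\<close>, its inverse \<open>1 / (1 - \<eta>)\<close>, and the Jacobian another
    \<open>1 / (1 - \<eta>)\<close>: this choice makes their product at most \<open>C0\<close>.\<close>
  define \<eta> where "\<eta> = (C0 - 1) / (1 + 2 * C0)"
  have \<eta>: "0 < \<eta>" "\<eta> < 1 / 2" using C0 by (auto simp: \<eta>_def field_simps)
  have "1 + \<eta> = C0 * (1 - 2 * \<eta>)" using C0 by (simp add: \<eta>_def field_simps)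
  also have "\<dots> \<le> C0 * (1 - \<eta>)\<^sup>2"
    using C0 by (intro mult_left_mono) (auto simp: power2_eq_square algebra_simps)
  finally have \<eta>C2: "1 + \<eta> \<le> C0 * (1 - \<eta>)\<^sup>2" .
  have "(1 - \<eta>)\<^sup>2 \<le> 1 - \<eta>" using \<eta> by (simp add: power2_eq_square mult_left_le)
  then have "C0 * (1 - \<eta>)\<^sup>2 \<le> C0 * (1 - \<eta>)" using C0 by (intro mult_left_mono) auto
  then have \<eta>C: "1 + \<eta> \<le> C0 * (1 - \<eta>)" using \<eta>C2 by linarith
  have Gd: "((\<lambda>v. g (ubar + v)) has_real_derivative g' (ubar + v)) (at v)" for v
    using DERIV_shift[of g "g' (ubar + v)" v ubar] g by (simp add: add.commute)
  have G'd: "((\<lambda>v. g' (ubar + v)) has_real_derivative c) (at 0)"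
    using DERIV_shift[of g' c 0 ubar] g' by (simp add: add.commute)
  obtain \<delta> H \<theta> where \<delta>: "0 < \<delta>" and Hd: "\<And>v. (H has_real_derivative \<theta> v) (at v)"
    and \<theta>_cont: "continuous_on UNIV \<theta>" and \<theta>: "\<And>v. \<bar>\<theta> v - 1\<bar> \<le> \<eta>" and H0: "H 0 = 0"
    and lin: "\<And>v. \<bar>v\<bar> \<le> \<delta> \<Longrightarrow> g (ubar + v) * \<theta> v = - r * H v"
    using linearizing_coordinate[OF Gd G'd _ _ r(2) \<eta>(1)] g0 r(1) by auto
  have \<theta>_bounds: "1 - \<eta> \<le> \<theta> v" "\<theta> v \<le> 1 + \<eta>" "0 < \<theta> v" for v using \<theta>[of v] \<eta> by auto
  obtain h where hd: "\<And>z. (h has_real_derivative inverse (\<theta> (h z))) (at z)"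
    and h_cont: "continuous_on UNIV h" and Hh: "\<And>z. H (h z) = z" and hH: "\<And>v. h (H v) = v"
    and h_bd: "\<And>z. \<bar>h z\<bar> \<le> \<bar>z\<bar> / (1 - \<eta>)"
    using linearizing_parametrization[OF Hd \<theta>_cont \<theta>_bounds(1) _ H0] \<eta> by auto
  have H_bd: "\<bar>H v\<bar> \<le> (1 + \<eta>) * \<bar>v\<bar>" for v
    using field_differentiable_bound[of UNIV H \<theta> "1 + \<eta>" v 0] Hd \<theta>_bounds H0
    by (auto simp: less_imp_le)
  define a where "a z = f' (ubar + h z)" for z
  have ad: "(a has_real_derivative f'' (ubar + h z) * inverse (\<theta> (h z))) (at z)" for z
    unfolding a_def
    by (rule DERIV_chain2[OF f']) (auto intro!: derivative_eq_intros hd)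
  obtain b where b: "continuous_on UNIV b" and ab: "\<And>z. a z = a 0 + r * z * b z"
    using difference_quotient_continuous[OF ad] r(2) by (metis less_irrefl)
  obtain B where B: "\<And>z. (B has_real_derivative b z) (at z)"
    using antiderivative_real_line[OF b] by blast
  obtain \<beta> where \<beta>: "0 < \<beta>" "\<And>z. \<bar>z\<bar> \<le> 1 \<Longrightarrow> \<bar>b z\<bar> \<le> \<beta>"
    using continuous_bounded_on_interval[OF b] by blast
  \<comment> \<open>The three bounds keep \<open>z\<close> in \<open>[-1, 1]\<close>, where \<open>\<beta>\<close> bounds \<open>b\<close>; keep \<open>u - ubar\<close> in \<open>[-\<delta>, \<delta>]\<close>,
    where \<open>H\<close> linearizes the source; and keep the Jacobian within \<open>\<eta>\<close> of \<open>1\<close>.\<close>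
  define \<epsilon> where "\<epsilon> = min (1 / 2) (min (\<delta> / C0) (\<eta> / (4 * \<beta>)))"
  have \<epsilon>: "0 < \<epsilon>" "\<epsilon> \<le> 1 / 2" "C0 * \<epsilon> \<le> \<delta>" "4 * \<beta> * \<epsilon> \<le> \<eta>"
  proof -
    show "0 < \<epsilon>" using \<delta> C0 \<eta> \<beta> by (simp add: \<epsilon>_def)
    show "\<epsilon> \<le> 1 / 2" unfolding \<epsilon>_def by (rule min.cobounded1)
    have "\<epsilon> \<le> \<delta> / C0" "\<epsilon> \<le> \<eta> / (4 * \<beta>)" by (simp_all add: \<epsilon>_def)
    then show "C0 * \<epsilon> \<le> \<delta>" "4 * \<beta> * \<epsilon> \<le> \<eta>" using C0 \<beta> by (auto simp: field_simps)
  qed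
  show ?thesis
  proof (intro exI[of _ \<epsilon>] conjI ballI allI impI \<epsilon>(1))
    fix v0 :: "real \<Rightarrow> real" and k k' :: real
    assume v0_BUC1: "v0 \<in> BUC 1 UNIV" and bounds: "\<forall>y. \<bar>v0 y\<bar> \<le> k" "\<forall>y. \<bar>deriv v0 y\<bar> \<le> k'"
      and k\<epsilon>: "k \<le> \<epsilon>" and k'\<epsilon>: "k' \<le> \<epsilon>"
    define v0' where "v0' = deriv v0"
    have v0_BUC: "v0 \<in> BUC 0 UNIV" and v0'_BUC: "v0' \<in> BUC 0 UNIV"
      and v0d: "(v0 has_real_derivative v0' y) (at y)" for y
      using v0_BUC1 unfolding One_nat_def BUC_Suc_real v0'_def
      by (simp_all add: DERIV_deriv_iff_real_differentiable)
    have k: "\<bar>v0 y\<bar> \<le> k" and k': "\<bar>v0' y\<bar> \<le> k'" for y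
      using bounds by (auto simp: v0'_def)
    have k0: "0 \<le> k" "0 \<le> k'" using k[of 0] k'[of 0] by linarith+
    define z0 where "z0 y = H (v0 y)" for y
    define z0' where "z0' y = \<theta> (v0 y) * v0' y" for y
    have z0d: "(z0 has_real_derivative z0' y) (at y)" for y
      unfolding z0_def z0'_def by (rule DERIV_chain2[OF Hd v0d])
    have "continuous_on UNIV H" by (rule DERIV_continuous_on[OF Hd])
    then have z0_BUC: "z0 \<in> BUC 0 UNIV"
      unfolding z0_def[abs_def] by (rule BUC_0_compose_continuous[OF v0_BUC])
    have z0'_BUC: "z0' \<in> BUC 0 UNIV"
      unfolding z0'_def[abs_def]
      by (rule BUC_0_mult[OF BUC_0_compose_continuous[OF v0_BUC \<theta>_cont] v0'_BUC])
    have z0: "\<bar>z0 y\<bar> \<le> (1 + \<eta>) * k" for y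
    proof -
      have "(1 + \<eta>) * \<bar>v0 y\<bar> \<le> (1 + \<eta>) * k" using k \<eta> by (intro mult_left_mono) auto
      then show ?thesis using H_bd[of "v0 y"] by (simp add: z0_def)
    qed
    have z0': "\<bar>z0' y\<bar> \<le> (1 + \<eta>) * k'" for y
      unfolding z0'_def abs_mult by (intro mult_mono k') (use \<theta>_bounds[of "v0 y"] \<eta> in auto)
    have z0_1: "\<bar>z0 y\<bar> \<le> 1" for y
    proof -
      have "(1 + \<eta>) * k \<le> 2 * (1 / 2)" using \<eta> k\<epsilon> \<epsilon>(2) k0 by (intro mult_mono) auto
      then show ?thesis using z0[of y] by linarith
    qed
    have slope: "\<bar>z0' y * (b (z0 y) - \<sigma> * b (\<sigma> * z0 y))\<bar> \<le> \<eta>" if \<sigma>: "0 \<le> \<sigma>" "\<sigma> \<le> 1" for \<sigma> y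
    proof -
      have "\<bar>\<sigma> * z0 y\<bar> \<le> 1 * 1"
        unfolding abs_mult by (intro mult_mono z0_1) (use \<sigma> in auto)
      then have "\<bar>\<sigma> * b (\<sigma> * z0 y)\<bar> \<le> 1 * \<beta>"
        unfolding abs_mult by (intro mult_mono \<beta>(2)) (use \<sigma> in \<open>auto simp: abs_mult\<close>)
      then have "\<bar>b (z0 y) - \<sigma> * b (\<sigma> * z0 y)\<bar> \<le> 2 * \<beta>"
        using \<beta>(2)[OF z0_1[of y]] by linarith
      moreover have "(1 + \<eta>) * k' \<le> 2 * \<epsilon>" using \<eta> k'\<epsilon> k0 by (intro mult_mono) auto
      then have "\<bar>z0' y\<bar> \<le> 2 * \<epsilon>" using z0'[of y] by linarith
      ultimately have "\<bar>z0' y\<bar> * \<bar>b (z0 y) - \<sigma> * b (\<sigma> * z0 y)\<bar> \<le> 2 * \<epsilon> * (2 * \<beta>)"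
        using \<epsilon>(1) by (intro mult_mono) auto
      then show ?thesis using \<epsilon>(4) by (simp add: abs_mult mult.assoc mult.left_commute mult.commute)
    qed
    define \<tau> where "\<tau> p = exp (- r * fst p)" for p :: "real \<times> real"
    have \<tau>_pos: "0 < \<tau> p" for p by (simp add: \<tau>_def)
    have \<tau>: "0 \<le> \<tau> p" "\<tau> p \<le> 1" if "p \<in> S" for p
      using that r(2) by (auto simp: \<tau>_def S_def)
    have \<eta>1: "\<eta> < 1" using \<eta> by simp
    obtain Y J where Y0: "\<And>x. Y (0, x) = x" and Y_uc: "uniformly_continuous_on S Y"
      and J_BUC: "J \<in> BUC 0 S" and J: "\<And>p. p \<in> S \<Longrightarrow> \<bar>J p - 1\<bar> \<le> \<eta>"
      and Yd: "\<And>p. p \<in> S \<Longrightarrow> (Y has_derivative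
        (\<lambda>q. (snd q - (a 0 + r * (\<tau> p * z0 (Y p)) * b (\<tau> p * z0 (Y p))) * fst q) / J p)) (at p within S)"
      by (rule characteristic_foot[OF r(2) B b z0d z0_BUC z0'_BUC \<eta>1 slope, where ?a0.0 = "a 0",
            folded \<tau>_def S_def]; (assumption | (rule that; (assumption | simp))))
    have J_pos: "1 - \<eta> \<le> J p" "0 < J p" if "p \<in> S" for p using J[OF that] \<eta> by auto
    define z where "z p = \<tau> p * z0 (Y p)" for p
    define zx where "zx p = \<tau> p * z0' (Y p) * inverse (J p)" for p
    define u where "u p = ubar + h (z p)" for p
    define ux where "ux p = zx p * inverse (\<theta> (h (z p)))" for p
    define ut where "ut p = g (u p) - f' (u p) * ux p" for p
    have z_le: "\<bar>z p\<bar> \<le> \<tau> p * ((1 + \<eta>) * k)" for p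
      using z0[of "Y p"] \<tau>_pos[of p] by (simp add: z_def abs_mult)
    have u_le: "\<bar>h (z p)\<bar> \<le> k * (C0 * \<tau> p)" for p
    proof -
      have "\<bar>h (z p)\<bar> * (1 - \<eta>) \<le> \<tau> p * ((1 + \<eta>) * k)"
        using h_bd[of "z p"] z_le[of p] \<eta> by (simp add: field_simps)
      also have "\<dots> \<le> \<tau> p * (C0 * (1 - \<eta>) * k)"
        using \<tau>_pos[of p] k0 \<eta>C by (intro mult_left_mono mult_right_mono) auto
      finally have "\<bar>h (z p)\<bar> * (1 - \<eta>) \<le> (k * (C0 * \<tau> p)) * (1 - \<eta>)" by (simp add: mult_ac)
      then show ?thesis using \<eta> by simp
    qed
    have h\<delta>: "\<bar>h (z p)\<bar> \<le> \<delta>" if "p \<in> S" for p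
    proof -
      have "k * (C0 * \<tau> p) \<le> \<epsilon> * (C0 * 1)"
        using k\<epsilon> k0 C0 \<tau>[OF that] \<epsilon> by (intro mult_mono) auto
      then show ?thesis using u_le[of p] \<epsilon>(3) by (simp add: mult.commute)
    qed
    have ux_le: "\<bar>ux p\<bar> \<le> k' * (C0 * \<tau> p)" if p: "p \<in> S" for p
    proof -
      let ?\<Theta> = "\<theta> (h (z p))"
      have "\<bar>ux p\<bar> * (1 - \<eta>)\<^sup>2 \<le> \<bar>ux p\<bar> * (J p * ?\<Theta>)"
        unfolding power2_eq_square using J_pos[OF p] \<theta>_bounds[of "h (z p)"] \<eta>
        by (intro mult_left_mono mult_mono) auto
      also have "\<dots> = \<tau> p * \<bar>z0' (Y p)\<bar>"
        using J_pos[OF p] \<theta>_bounds(3)[of "h (z p)"] \<tau>_pos[of p] by (simp add: ux_def zx_def abs_mult field_simps)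
      also have "\<dots> \<le> \<tau> p * ((1 + \<eta>) * k')"
        using z0' \<tau>_pos[of p] by (intro mult_left_mono) auto
      also have "\<dots> \<le> \<tau> p * (C0 * (1 - \<eta>)\<^sup>2 * k')"
        using \<tau>_pos[of p] k0 \<eta>C2 by (intro mult_left_mono mult_right_mono) auto
      finally have "\<bar>ux p\<bar> * (1 - \<eta>)\<^sup>2 \<le> (k' * (C0 * \<tau> p)) * (1 - \<eta>)\<^sup>2" by (simp add: mult_ac)
      then show ?thesis using \<eta> by simp
    qed
    have ud: "(u has_derivative (\<lambda>q. fst q * ut p + snd q * ux p)) (at p within S)" if p: "p \<in> S" for p
    proof -
      have "a (z p) = a 0 + r * (\<tau> p * z0 (Y p)) * b (\<tau> p * z0 (Y p))"
        using ab[of "z p"] by (simp add: z_def)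
      then have "(Y has_derivative (\<lambda>q. (snd q - a (z p) * fst q) / J p)) (at p within S)"
        using Yd[OF p] by simp
      then have "((\<lambda>q. z0 (Y q)) has_derivative (\<lambda>q. ((snd q - a (z p) * fst q) / J p) * z0' (Y p))) (at p within S)"
        by (rule DERIV_compose_FDERIV[OF z0d])
      note zY = this
      have \<tau>d: "(\<tau> has_derivative (\<lambda>q. (- r * fst q) * \<tau> p)) (at p within S)"
        unfolding \<tau>_def[abs_def]
        by (rule DERIV_compose_FDERIV[OF DERIV_exp]) (auto intro!: derivative_eq_intros)
      have z_eq: "(\<lambda>p. \<tau> p * z0 (Y p)) = z" by (simp add: fun_eq_iff z_def)
      have "(z has_derivative (\<lambda>q. \<tau> p * (((snd q - a (z p) * fst q) / J p) * z0' (Y p))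
          + ((- r * fst q) * \<tau> p) * z0 (Y p))) (at p within S)"
        by (rule has_derivative_mult[OF \<tau>d zY, unfolded z_eq])
      then have "(z has_derivative (\<lambda>q. fst q * (- r * z p - a (z p) * zx p) + snd q * zx p)) (at p within S)"
        by (rule has_derivative_eq_rhs)
          (simp add: fun_eq_iff zx_def z_def diff_divide_distrib divide_inverse algebra_simps)
      then have "((\<lambda>q. h (z q)) has_derivative
          (\<lambda>q. (fst q * (- r * z p - a (z p) * zx p) + snd q * zx p) * inverse (\<theta> (h (z p))))) (at p within S)"
        by (rule DERIV_compose_FDERIV[OF hd])
      then have "(u has_derivative
          (\<lambda>q. (fst q * (- r * z p - a (z p) * zx p) + snd q * zx p) * inverse (\<theta> (h (z p))))) (at p within S)"
        unfolding u_def by (auto intro!: derivative_eq_intros)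
      moreover have "(- r * z p - a (z p) * zx p) * inverse (\<theta> (h (z p))) = ut p"
      proof -
        have "g (u p) * \<theta> (h (z p)) = - r * z p"
          using lin[OF h\<delta>[OF p]] by (simp add: Hh u_def)
        then have "- r * z p * inverse (\<theta> (h (z p))) = g (u p)"
          using \<theta>_bounds(3)[of "h (z p)"] by (simp add: field_simps)
        then show ?thesis
          by (simp add: ut_def ux_def a_def u_def left_diff_distrib mult.assoc)
      qed
      then have "(\<lambda>q. (fst q * (- r * z p - a (z p) * zx p) + snd q * zx p) * inverse (\<theta> (h (z p))))
          = (\<lambda>q. fst q * ut p + snd q * ux p)"
        by (simp add: fun_eq_iff ux_def distrib_right mult.assoc)
      ultimately show ?thesis by simp
    qed
    have \<tau>_BUC: "\<tau> \<in> BUC 0 S" using BUC_0_exp_decay[OF r(2)] by (simp add: \<tau>_def[abs_def] S_def)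
    have Y1: "(\<lambda>p. z0 (Y p)) \<in> BUC 0 S" "(\<lambda>p. z0' (Y p)) \<in> BUC 0 S"
      by (rule BUC_0_reparam[OF _ Y_uc subset_UNIV], fact)+
    have z_BUC: "z \<in> BUC 0 S"
      unfolding z_def[abs_def] by (rule BUC_0_mult[OF \<tau>_BUC Y1(1)])
    have u_BUC: "u \<in> BUC 0 S"
      unfolding u_def[abs_def]
      by (rule BUC_0_add[OF BUC_0_const BUC_0_compose_continuous[OF z_BUC h_cont]])
    \<comment> \<open>Truncating the Jacobian from below makes its reciprocal a continuous function of it on the whole line.\<close>
    have "(\<lambda>p. inverse (max (1 - \<eta>) (J p))) \<in> BUC 0 S"
      by (rule BUC_0_compose_continuous[OF J_BUC]) (use \<eta> in \<open>auto intro!: continuous_intros\<close>)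
    then have "(\<lambda>p. inverse (J p)) \<in> BUC 0 S"
      by (rule BUC_0_cong[rotated]) (use J_pos in \<open>auto simp: max_def\<close>)
    then have zx_BUC: "zx \<in> BUC 0 S"
      unfolding zx_def[abs_def] by (rule BUC_0_mult[OF BUC_0_mult[OF \<tau>_BUC Y1(2)]])
    have "continuous_on UNIV (\<lambda>z. inverse (\<theta> (h z)))"
    proof (intro continuous_intros ballI)
      show "continuous_on UNIV (\<lambda>z. \<theta> (h z))"
        by (rule continuous_on_compose2[OF \<theta>_cont h_cont]) auto
      show "\<theta> (h z) \<noteq> 0" for z using \<theta>_bounds(3)[of "h z"] by simp
    qed
    then have ux_BUC: "ux \<in> BUC 0 S"
      unfolding ux_def[abs_def] by (rule BUC_0_mult[OF zx_BUC BUC_0_compose_continuous[OF z_BUC]])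
    have "continuous_on UNIV g" "continuous_on UNIV f'"
      by (rule DERIV_continuous_on[OF g], rule DERIV_continuous_on[OF f'])
    then have ut_BUC: "ut \<in> BUC 0 S"
      unfolding ut_def[abs_def]
      by (intro BUC_0_diff[OF _ BUC_0_mult[OF _ ux_BUC]] BUC_0_compose_continuous[OF u_BUC])
    have uB1: "u \<in> BUC 1 S"
    proof (rule BUC_1_I[OF _ _ ud])
      show "convex S" unfolding S_def by (intro convex_Times convex_real_interval convex_UNIV)
      show "bounded (u ` S)" using u_BUC by simp
      show "(\<lambda>p. fst i * ut p + snd i * ux p) \<in> BUC 0 S" if "i \<in> Basis" for i :: "real \<times> real"
        by (intro BUC_0_add BUC_0_mult[OF BUC_0_const] ut_BUC ux_BUC)
    qed
    have ut: "((\<lambda>s. u (s, x)) has_real_derivative ut (t, x)) (at t within {0..})" if t: "0 \<le> t" for t x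
    proof -
      have "((\<lambda>s. u (s, x)) has_derivative (\<lambda>s. fst (s, 0::real) * ut (t, x) + snd (s, 0::real) * ux (t, x)))
          (at t within {0..})"
        by (rule has_derivative_in_compose2[OF ud, where f = "\<lambda>s. (s, x)"])
          (use t in \<open>auto simp: S_def intro!: derivative_eq_intros\<close>)
      then show ?thesis by (simp add: has_field_derivative_def mult_commute_abs)
    qed
    have ux: "((\<lambda>y. u (t, y)) has_real_derivative ux (t, x)) (at x)" if t: "0 \<le> t" for t x
    proof -
      have "((\<lambda>y. u (t, y)) has_derivative (\<lambda>y. fst (0::real, y) * ut (t, x) + snd (0::real, y) * ux (t, x))) (at x)"
        by (rule has_derivative_in_compose2[OF ud, where f = "\<lambda>y. (t, y)"])
          (use t in \<open>auto simp: S_def intro!: derivative_eq_intros\<close>)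
      then show ?thesis by (simp add: has_field_derivative_def mult_commute_abs)
    qed
    have "classical_solution f g (\<lambda>x. ubar + v0 x) u"
      unfolding classical_solution_def
    proof (intro conjI allI impI)
      show "u \<in> C_diff 1 ({0..} \<times> UNIV)"
        using uB1 BUC_subset_C_diff unfolding S_def by blast
      show "u (0, x) = ubar + v0 x" for x
        by (simp add: u_def z_def \<tau>_def Y0 z0_def hH)
      show "\<exists>a b. ((\<lambda>s. u (s, x)) has_real_derivative a) (at t within {0..}) \<and>
          ((\<lambda>y. f (u (t, y))) has_real_derivative b) (at x) \<and> a + b = g (u (t, x))" if "0 \<le> t" for t x
        using ut[OF that] DERIV_chain2[OF f ux[OF that]] by (force simp: ut_def)
    qed
    moreover have "\<bar>u (t, x) - ubar\<bar> \<le> k * (C0 * exp (- r * t))" for t x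
      using u_le[of "(t, x)"] by (simp add: u_def \<tau>_def)
    moreover have "\<bar>ux (t, x)\<bar> \<le> k' * (C0 * exp (- r * t))" if "0 \<le> t" for t x
      using ux_le[of "(t, x)"] that by (simp add: \<tau>_def S_def)
    ultimately show "\<exists>u ux. u \<in> BUC 1 S \<and> ux \<in> BUC 0 S \<and> classical_solution f g (\<lambda>x. ubar + v0 x) u \<and>
      (\<forall>t\<ge>0. \<forall>x. ((\<lambda>y. u (t, y)) has_real_derivative ux (t, x)) (at x) \<and>
        \<bar>u (t, x) - ubar\<bar> \<le> k * (C0 * exp (- r * t)) \<and> \<bar>ux (t, x)\<bar> \<le> k' * (C0 * exp (- r * t)))"
      using uB1 ux_BUC ux by blast
  qed
qed

section \<open>Uniqueness\<close>

lemma at_within_halfline_neq_bot: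
  assumes "0 \<le> t"
  shows "at t within {0..} \<noteq> (bot :: real filter)"
proof -
  have "at_right t \<le> at t within {0..}"
    by (rule at_le) (use assms in auto)
  then show ?thesis
    using trivial_limit_at_right_real[of t] by (metis bot.extremum_uniqueI)
qed

text \<open>The definition of a solution speaks of derivatives along the axes only. Expressing them through
  one total derivative allows differentiation along characteristic directions.\<close>

lemma classical_solution_partials:
  fixes f f' g u0 :: "real \<Rightarrow> real"
  defines "S \<equiv> {0..} \<times> (UNIV :: real set)"
  assumes u: "classical_solution f g u0 u" and f: "\<And>v. (f has_real_derivative f' v) (at v)"
  obtains ut ux where
    "\<And>p. p \<in> S \<Longrightarrow> (u has_derivative (\<lambda>q. fst q * ut p + snd q * ux p)) (at p within S)"
    "continuous_on S ux" "\<And>p. p \<in> S \<Longrightarrow> ut p + f' (u p) * ux p = g (u p)"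
proof -
  have "u \<in> C_diff 1 S" using u by (simp add: classical_solution_def S_def)
  then obtain D where D: "\<And>p. p \<in> S \<Longrightarrow> (u has_derivative D p) (at p within S)"
    and cont: "\<And>b. b \<in> Basis \<Longrightarrow> continuous_on S (\<lambda>p. D p b)"
    by auto
  have D_eq: "D p = (\<lambda>q. fst q * D p (1, 0) + snd q * D p (0, 1))" if p: "p \<in> S" for p
  proof
    fix q :: "real \<times> real"
    have lin: "linear (D p)" using D[OF p] has_derivative_linear by blast
    have "q = fst q *\<^sub>R (1, 0) + snd q *\<^sub>R (0, 1)" by (cases q) simp
    then have "D p q = D p (fst q *\<^sub>R (1, 0) + snd q *\<^sub>R (0, 1))" by simp
    also have "\<dots> = fst q * D p (1, 0) + snd q * D p (0, 1)"
      by (simp add: linear_add[OF lin] linear_scale[OF lin] del: scaleR_Pair)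
    finally show "D p q = fst q * D p (1, 0) + snd q * D p (0, 1)" .
  qed
  show thesis
  proof (rule that[of "\<lambda>p. D p (1, 0)" "\<lambda>p. D p (0, 1)"])
    show "(u has_derivative (\<lambda>q. fst q * D p (1, 0) + snd q * D p (0, 1))) (at p within S)"
      if "p \<in> S" for p
      using D[OF that] D_eq[OF that] by simp
    show "continuous_on S (\<lambda>p. D p (0, 1))"
      by (rule cont) (simp add: Basis_prod_def)
    fix p assume p: "p \<in> S"
    obtain t x where tx: "p = (t, x)" and t: "0 \<le> t" using p by (auto simp: S_def)
    obtain a b where a: "((\<lambda>s. u (s, x)) has_real_derivative a) (at t within {0..})"
      and b: "((\<lambda>y. f (u (t, y))) has_real_derivative b) (at x)" and ab: "a + b = g (u (t, x))"
      using u t unfolding classical_solution_def by blast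
    have "D (t, x) (h, 0) = D p (1, 0) * h" "D (t, x) (0, h) = D p (0, 1) * h" for h
      using fun_cong[OF D_eq[OF p], of "(h, 0)"] fun_cong[OF D_eq[OF p], of "(0, h)"] tx
      by (simp_all add: mult.commute)
    then have D_axes: "(\<lambda>h. D (t, x) (h, 0)) = (*) (D p (1, 0))" "(\<lambda>h. D (t, x) (0, h)) = (*) (D p (0, 1))"
      by (simp_all add: fun_eq_iff)
    have "((\<lambda>s. u (s, x)) has_derivative (\<lambda>h. D (t, x) (h, 0))) (at t within {0..})"
      by (rule has_derivative_in_compose2[OF D, where f = "\<lambda>s. (s, x)"])
        (use t in \<open>auto simp: S_def intro!: derivative_eq_intros\<close>)
    then have "((\<lambda>s. u (s, x)) has_real_derivative D p (1, 0)) (at t within {0..})"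
      by (simp only: D_axes has_field_derivative_def)
    with a have a_eq: "a = D p (1, 0)"
      using has_field_derivative_unique at_within_halfline_neq_bot[OF t] by blast
    have "((\<lambda>y. u (t, y)) has_derivative (\<lambda>h. D (t, x) (0, h))) (at x)"
      by (rule has_derivative_in_compose2[OF D, where f = "\<lambda>y. (t, y)"])
        (use t in \<open>auto simp: S_def intro!: derivative_eq_intros\<close>)
    then have "((\<lambda>y. u (t, y)) has_real_derivative D p (0, 1)) (at x)"
      by (simp only: D_axes has_field_derivative_def)
    then have "((\<lambda>y. f (u (t, y))) has_real_derivative f' (u (t, x)) * D p (0, 1)) (at x)"
      by (rule DERIV_chain2[OF f])
    with b have "b = f' (u p) * D p (0, 1)"
      using DERIV_unique tx by blast
    then show "D p (1, 0) + f' (u p) * D p (0, 1) = g (u p)"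
      using ab a_eq tx by simp
  qed
qed

definition backward_cone :: "real \<Rightarrow> real \<Rightarrow> real \<Rightarrow> real \<Rightarrow> (real \<times> real) set" where
  "backward_cone M T x0 s = {p. 0 \<le> fst p \<and> fst p \<le> s \<and> \<bar>snd p - x0\<bar> \<le> M * (T - fst p)}"

lemma compact_backward_cone:
  assumes "0 \<le> M"
  shows "compact (backward_cone M T x0 s)"
proof -
  have "compact (({0..s} \<times> {x0 - M * T..x0 + M * T}) \<inter>
      {p. \<bar>snd p - x0\<bar> \<le> M * (T - fst p)})"
    by (intro compact_Int_closed compact_Times compact_Icc closed_Collect_le continuous_intros)
  also have "({0..s} \<times> {x0 - M * T..x0 + M * T}) \<inter> {p. \<bar>snd p - x0\<bar> \<le> M * (T - fst p)}
      = backward_cone M T x0 s"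
  proof -
    have "\<bar>snd p - x0\<bar> \<le> M * T" if "p \<in> backward_cone M T x0 s" for p
    proof -
      have "M * (T - fst p) \<le> M * T"
        using that assms by (intro mult_left_mono) (auto simp: backward_cone_def)
      then show ?thesis using that by (auto simp: backward_cone_def)
    qed
    then show ?thesis by (force simp: backward_cone_def abs_le_iff)
  qed
  finally show ?thesis .
qed

text \<open>A maximum principle. At a positive maximum of \<open>d\<^sup>2 exp (- 2 (N + 1) t)\<close> over the truncated cone,
  consider the backward direction \<open>(-1, -a)\<close>. It points into the cone because \<open>\<bar>a\<bar> \<le> M\<close>, while the
  differential inequality makes the weighted square strictly increase along it.\<close>

lemma transport_vanishes_on_cone:
  fixes d a dt dx :: "real \<times> real \<Rightarrow> real"
  defines "S \<equiv> {0..} \<times> (UNIV :: real set)"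
  assumes M: "0 \<le> M"
    and d: "\<And>p. p \<in> S \<Longrightarrow> (d has_derivative (\<lambda>q. fst q * dt p + snd q * dx p)) (at p within S)"
    and a: "\<And>p. p \<in> backward_cone M T x0 s \<Longrightarrow> \<bar>a p\<bar> \<le> M"
    and eqn: "\<And>p. p \<in> backward_cone M T x0 s \<Longrightarrow> \<bar>dt p + a p * dx p\<bar> \<le> N * \<bar>d p\<bar>"
    and init: "\<And>x. d (0, x) = 0" and p: "p \<in> backward_cone M T x0 s"
  shows "d p = 0"
proof (rule ccontr)
  let ?K = "backward_cone M T x0 s"
  have KS: "?K \<subseteq> S" by (auto simp: backward_cone_def S_def)
  define c where "c = - 2 * (N + 1)"
  define E where "E p = (d p)\<^sup>2 * exp (c * fst p)" for p
  define E' where "E' p q = exp (c * fst p) * (2 * d p * (fst q * dt p + snd q * dx p) + c * fst q * (d p)\<^sup>2)"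
    for p q :: "real \<times> real"
  have Ed: "(E has_derivative E' p) (at p within S)" if "p \<in> S" for p
  proof -
    have "((\<lambda>q. exp (c * fst q)) has_derivative (\<lambda>q. (c * fst q) * exp (c * fst p))) (at p within S)"
      by (rule DERIV_compose_FDERIV[OF DERIV_exp]) (auto intro!: derivative_eq_intros)
    from has_derivative_mult[OF has_derivative_mult[OF d[OF that] d[OF that]] this]
    show ?thesis
      unfolding E_def power2_eq_square
      by (rule has_derivative_eq_rhs) (simp add: fun_eq_iff E'_def power2_eq_square algebra_simps)
  qed
  have "continuous_on S E"
    by (rule has_derivative_continuous_on[OF Ed])
  then have "continuous_on ?K E" using KS by (rule continuous_on_subset)
  then obtain m where m: "m \<in> ?K" "\<And>q. q \<in> ?K \<Longrightarrow> E q \<le> E m"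
    using continuous_attains_sup[OF compact_backward_cone[OF M]] p by blast
  assume "d p \<noteq> 0"
  then have "0 < E p" by (simp add: E_def)
  with m(2)[OF p] have "d m \<noteq> 0" by (auto simp: E_def)
  then have fm: "0 < fst m"
    using init[of "snd m"] m(1) by (cases m) (auto simp: backward_cone_def le_less)
  \<comment> \<open>The backward path through the maximum; it stays in the cone until it reaches time \<open>0\<close>.\<close>
  define \<gamma> where "\<gamma> \<sigma> = (fst m - \<sigma>, snd m - \<sigma> * a m)" for \<sigma>
  have \<gamma>K: "\<gamma> \<sigma> \<in> ?K" if "\<sigma> \<in> {0..fst m}" for \<sigma>
  proof -
    have "\<sigma> * \<bar>a m\<bar> \<le> \<sigma> * M" using a[OF m(1)] that by (intro mult_left_mono) auto
    moreover have "\<bar>snd m - \<sigma> * a m - x0\<bar> \<le> \<bar>snd m - x0\<bar> + \<sigma> * \<bar>a m\<bar>"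
      using that abs_triangle_ineq4[of "snd m - x0" "\<sigma> * a m"] by (simp add: abs_mult algebra_simps)
    ultimately have "\<bar>snd m - \<sigma> * a m - x0\<bar> \<le> M * (T - (fst m - \<sigma>))"
      using m(1) by (simp add: backward_cone_def algebra_simps)
    then show ?thesis using that m(1) by (auto simp: \<gamma>_def backward_cone_def)
  qed
  have "((\<lambda>\<sigma>. E (\<gamma> \<sigma>)) has_derivative (\<lambda>h. E' m (- h, - h * a m))) (at 0 within {0..fst m})"
  proof -
    have \<gamma>d: "(\<gamma> has_derivative (\<lambda>h. (- h, - h * a m))) (at 0 within {0..fst m})"
      unfolding \<gamma>_def by (auto intro!: derivative_eq_intros)
    have img: "\<gamma> ` {0..fst m} \<subseteq> S" using \<gamma>K KS by blast
    have "((\<lambda>\<sigma>. E (\<gamma> \<sigma>)) has_derivative (\<lambda>h. E' (\<gamma> 0) (- h, - h * a m))) (at 0 within {0..fst m})"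
      by (rule has_derivative_in_compose2[OF Ed img _ \<gamma>d]) (use fm in auto)
    then show ?thesis by (simp add: \<gamma>_def)
  qed
  moreover have "(\<lambda>h. E' m (- h, - h * a m)) =
      (*) (2 * exp (c * fst m) * ((N + 1) * (d m)\<^sup>2 - d m * (dt m + a m * dx m)))"
    by (simp add: fun_eq_iff E'_def c_def algebra_simps)
  ultimately have der: "((\<lambda>\<sigma>. E (\<gamma> \<sigma>)) has_real_derivative
      2 * exp (c * fst m) * ((N + 1) * (d m)\<^sup>2 - d m * (dt m + a m * dx m))) (at 0 within {0..fst m})"
    by (simp only: has_field_derivative_def)
  have "d m * (dt m + a m * dx m) \<le> \<bar>d m\<bar> * \<bar>dt m + a m * dx m\<bar>"
    by (metis abs_ge_self abs_mult)
  also have "\<dots> \<le> \<bar>d m\<bar> * (N * \<bar>d m\<bar>)"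
    by (intro mult_left_mono eqn m(1)) auto
  also have "\<dots> < (N + 1) * (d m)\<^sup>2"
  proof -
    have "0 < (d m)\<^sup>2" using \<open>d m \<noteq> 0\<close> by simp
    then show ?thesis by (simp add: power2_eq_square algebra_simps flip: abs_mult)
  qed
  finally have "0 < 2 * exp (c * fst m) * ((N + 1) * (d m)\<^sup>2 - d m * (dt m + a m * dx m))"
    by simp
  from has_real_derivative_pos_inc_right[OF der this] obtain \<rho> where
    \<rho>: "0 < \<rho>" "\<And>h. 0 < h \<Longrightarrow> h \<in> {0..fst m} \<Longrightarrow> h < \<rho> \<Longrightarrow> E (\<gamma> 0) < E (\<gamma> h)"
    by auto
  define h where "h = min (fst m) (\<rho> / 2)"
  have h: "0 < h" "h \<in> {0..fst m}" "h < \<rho>" using fm \<rho>(1) by (auto simp: h_def)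
  have "\<gamma> 0 = m" by (simp add: \<gamma>_def)
  then show False using \<rho>(2)[OF h] m(2)[OF \<gamma>K[OF h(2)]] by simp
qed

text \<open>The solution \<open>w\<close> may be unbounded, and with it its speed of propagation \<open>f'(w)\<close>. The cone is
  therefore given the slope \<open>M\<close> that bounds \<open>f'\<close> on all values within distance \<open>1\<close> of the range of \<open>u\<close>. As
  long as \<open>\<bar>w - u\<bar> \<le> 1\<close> on the part of the cone up to some time, the maximum principle yields \<open>w = u\<close>
  there. Hence, by continuity, \<open>\<bar>w - u\<bar>\<close> cannot reach \<open>1\<close> for a first time.\<close>

lemma classical_solution_unique:
  fixes f f' f'' g g' u0 :: "real \<Rightarrow> real"
  defines "S \<equiv> {0..} \<times> (UNIV :: real set)"
  assumes f: "\<And>v. (f has_real_derivative f' v) (at v)" and f': "\<And>v. (f' has_real_derivative f'' v) (at v)"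
    and f'': "continuous_on UNIV f''"
    and g: "\<And>v. (g has_real_derivative g' v) (at v)" and g': "continuous_on UNIV g'"
    and u: "classical_solution f g u0 u" and w: "classical_solution f g u0 w"
    and bd: "bounded (u ` S)" and t: "0 \<le> t"
  shows "w (t, x) = u (t, x)"
proof -
  obtain ut ux where ud: "\<And>p. p \<in> S \<Longrightarrow> (u has_derivative (\<lambda>q. fst q * ut p + snd q * ux p)) (at p within S)"
    and ux: "continuous_on S ux" and u_eq: "\<And>p. p \<in> S \<Longrightarrow> ut p + f' (u p) * ux p = g (u p)"
    by (rule classical_solution_partials[OF u f, folded S_def]) (rule that; (assumption | simp))
  obtain wt wx where wd: "\<And>p. p \<in> S \<Longrightarrow> (w has_derivative (\<lambda>q. fst q * wt p + snd q * wx p)) (at p within S)"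
    and w_eq: "\<And>p. p \<in> S \<Longrightarrow> wt p + f' (w p) * wx p = g (w p)"
    by (rule classical_solution_partials[OF w f, folded S_def]) (rule that; (assumption | simp))
  define d where "d p = w p - u p" for p
  define dt where "dt p = wt p - ut p" for p
  define dx where "dx p = wx p - ux p" for p
  have dd: "(d has_derivative (\<lambda>q. fst q * dt p + snd q * dx p)) (at p within S)" if "p \<in> S" for p
    unfolding d_def
    by (rule has_derivative_eq_rhs[OF has_derivative_diff[OF wd[OF that] ud[OF that]]])
      (simp add: fun_eq_iff dt_def dx_def algebra_simps)
  have d0: "d (0, x) = 0" for x
  proof -
    have "u (0, x) = u0 x" "w (0, x) = u0 x" using u w unfolding classical_solution_def by blast+
    then show ?thesis by (simp add: d_def)
  qed
  have d_cont: "continuous_on S d" by (rule has_derivative_continuous_on[OF dd])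
  obtain U where U: "\<And>p. p \<in> S \<Longrightarrow> \<bar>u p\<bar> \<le> U"
    using bd by (auto simp: bounded_iff)
  have "continuous_on UNIV f'" by (rule DERIV_continuous_on[OF f'])
  then obtain M where M: "0 < M" "\<And>z. \<bar>z\<bar> \<le> U + 1 \<Longrightarrow> \<bar>f' z\<bar> \<le> M"
    using continuous_bounded_on_interval by blast
  obtain Lf where Lf: "0 < Lf" "\<And>x y. \<bar>x\<bar> \<le> U + 1 \<Longrightarrow> \<bar>y\<bar> \<le> U + 1 \<Longrightarrow> \<bar>f' x - f' y\<bar> \<le> Lf * \<bar>x - y\<bar>"
    using C1_lipschitz_on_interval[OF f' f''] by blast
  obtain Lg where Lg: "0 < Lg" "\<And>x y. \<bar>x\<bar> \<le> U + 1 \<Longrightarrow> \<bar>y\<bar> \<le> U + 1 \<Longrightarrow> \<bar>g x - g y\<bar> \<le> Lg * \<bar>x - y\<bar>"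
    using C1_lipschitz_on_interval[OF g g'] by blast
  let ?K = "backward_cone M t x"
  have KS: "?K s \<subseteq> S" for s by (auto simp: backward_cone_def S_def)
  have K_compact: "compact (?K t)" using M(1) by (intro compact_backward_cone) auto
  then have "bounded (ux ` ?K t)"
    by (intro compact_imp_bounded compact_continuous_image continuous_on_subset[OF ux KS])
  then obtain X where X: "\<And>p. p \<in> ?K t \<Longrightarrow> \<bar>ux p\<bar> \<le> X"
    by (auto simp: bounded_iff)
  have vanish: "d p = 0" if s: "s \<le> t" and le: "\<And>p. p \<in> ?K s \<Longrightarrow> \<bar>d p\<bar> \<le> 1" and p: "p \<in> ?K s" for s p
  proof (rule transport_vanishes_on_cone[where a = "\<lambda>p. f' (w p)" and N = "Lg + Lf * X"])
    show "0 \<le> M" using M(1) by simp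
    fix q assume q: "q \<in> ?K s"
    have qS: "q \<in> S" using KS q by blast
    have uq: "\<bar>u q\<bar> \<le> U + 1" "\<bar>w q\<bar> \<le> U + 1" using U[OF qS] le[OF q] by (simp_all add: d_def)
    show "\<bar>f' (w q)\<bar> \<le> M" by (rule M(2)[OF uq(2)])
    have qt: "q \<in> ?K t" using q s by (auto simp: backward_cone_def)
    \<comment> \<open>The difference is transported with the speed of \<open>w\<close>.\<close>
    have "dt q + f' (w q) * dx q = (g (w q) - g (u q)) - (f' (w q) - f' (u q)) * ux q"
      using u_eq[OF qS] w_eq[OF qS] by (simp add: dt_def dx_def algebra_simps)
    also have "\<bar>\<dots>\<bar> \<le> \<bar>g (w q) - g (u q)\<bar> + \<bar>f' (w q) - f' (u q)\<bar> * \<bar>ux q\<bar>"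
      by (metis abs_mult abs_triangle_ineq4)
    also have "\<dots> \<le> Lg * \<bar>d q\<bar> + (Lf * \<bar>d q\<bar>) * X"
      unfolding d_def by (intro add_mono mult_mono Lg Lf X qt uq) (use Lf(1) in auto)
    finally show "\<bar>dt q + f' (w q) * dx q\<bar> \<le> (Lg + Lf * X) * \<bar>d q\<bar>"
      by (simp add: algebra_simps)
  next
    show "(d has_derivative (\<lambda>q. fst q * dt p + snd q * dx p)) (at p within {0..} \<times> UNIV)"
      if "p \<in> {0..} \<times> UNIV" for p using dd that by (simp add: S_def)
  qed (use d0 p in auto)
  have small: "\<bar>d p\<bar> < 1" if "p \<in> ?K t" for p
  proof (rule ccontr)
    assume "\<not> \<bar>d p\<bar> < 1"
    \<comment> \<open>The places in the cone where \<open>w\<close> has left the unit neighbourhood of \<open>u\<close>, and an earliest one \<open>m\<close>.\<close>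
    define Bad where "Bad = {q \<in> ?K t. 1 \<le> \<bar>d q\<bar>}"
    have "compact Bad"
    proof -
      have "continuous_on (?K t) (\<lambda>q. \<bar>d q\<bar>)"
        by (intro continuous_intros continuous_on_subset[OF d_cont KS])
      then have "closed (?K t \<inter> (\<lambda>q. \<bar>d q\<bar>) -` {1..})"
        by (rule continuous_closed_preimage) (use K_compact compact_imp_closed in auto)
      moreover have "Bad = ?K t \<inter> (?K t \<inter> (\<lambda>q. \<bar>d q\<bar>) -` {1..})" by (auto simp: Bad_def)
      ultimately show ?thesis using compact_Int_closed[OF K_compact] by metis
    qed
    moreover have "p \<in> Bad" using that \<open>\<not> \<bar>d p\<bar> < 1\<close> by (simp add: Bad_def)
    then have "Bad \<noteq> {}" by blast
    ultimately obtain m where m: "m \<in> Bad" "\<And>q. q \<in> Bad \<Longrightarrow> fst m \<le> fst q"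
      using continuous_attains_inf[OF _ _ continuous_on_fst[OF continuous_on_id], of Bad] by blast
    have mK: "m \<in> ?K t" and md: "1 \<le> \<bar>d m\<bar>" using m(1) by (auto simp: Bad_def)
    have "fst m \<noteq> 0" using md d0[of "snd m"] by (cases m) auto
    then have fm: "0 < fst m" "fst m \<le> t" using mK by (auto simp: backward_cone_def)
    \<comment> \<open>Vertical approach to \<open>m\<close> from earlier times, where the difference already vanishes.\<close>
    define \<gamma> where "\<gamma> \<sigma> = (fst m - \<sigma>, snd m)" for \<sigma>
    have \<gamma>K: "\<gamma> \<sigma> \<in> ?K (fst m - \<sigma>)" if "\<sigma> \<in> {0..fst m}" for \<sigma>
    proof -
      have "M * (t - fst m) \<le> M * (t - (fst m - \<sigma>))"
        using M(1) that by (intro mult_left_mono) auto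
      then show ?thesis using mK that by (auto simp: \<gamma>_def backward_cone_def)
    qed
    have zero: "d (\<gamma> \<sigma>) = 0" if \<sigma>: "\<sigma> \<in> {0<..fst m}" for \<sigma>
    proof (rule vanish[of "fst m - \<sigma>"])
      show "\<bar>d q\<bar> \<le> 1" if q: "q \<in> ?K (fst m - \<sigma>)" for q
      proof (rule ccontr)
        assume "\<not> \<bar>d q\<bar> \<le> 1"
        then have "q \<in> Bad" using q \<sigma> fm by (auto simp: Bad_def backward_cone_def)
        from m(2)[OF this] show False using q \<sigma> by (auto simp: backward_cone_def)
      qed
    qed (use \<gamma>K \<sigma> fm in auto)
    have "continuous_on {0..fst m} (\<lambda>\<sigma>. d (\<gamma> \<sigma>))"
    proof (rule continuous_on_compose2[OF d_cont])
      show "continuous_on {0..fst m} \<gamma>" unfolding \<gamma>_def by (intro continuous_intros)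
      show "\<gamma> ` {0..fst m} \<subseteq> S" using \<gamma>K KS by blast
    qed
    then have "d (\<gamma> 0) = 0"
      using continuous_constant_on_closure[of "{0<..fst m}" "\<lambda>\<sigma>. d (\<gamma> \<sigma>)" 0 0] zero fm by auto
    then show False using md by (simp add: \<gamma>_def)
  qed
  have "d (t, x) = 0"
    by (rule vanish[of t]) (use small t in \<open>auto simp: backward_cone_def less_imp_le\<close>)
  then show ?thesis by (simp add: d_def)
qed

section \<open>Well-posedness near the equilibrium\<close>

lemma C_diff_2_derivatives:
  fixes k :: "real \<Rightarrow> real"
  assumes "k \<in> C_diff 2 UNIV"
  shows "(k has_real_derivative deriv k x) (at x)"
    "(deriv k has_real_derivative deriv (deriv k) x) (at x)" "continuous_on UNIV (deriv (deriv k))"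
  using assms unfolding numeral_2_eq_2 C_diff_Suc_real
  by (simp_all add: DERIV_deriv_iff_real_differentiable)

theorem proposition1p2:
  fixes f g :: "real \<Rightarrow> real" and ubar C0 :: real
  assumes "f \<in> C_diff 2 UNIV" and "g \<in> C_diff 2 UNIV"
    and "g ubar = 0" and "deriv g ubar < 0"
    and "C0 > 1"
  shows "\<exists>\<epsilon>::real. \<epsilon> > 0 \<and>
    (\<forall>v0 \<in> BUC 1 UNIV. W1infty_norm v0 \<le> ereal \<epsilon> \<longrightarrow>
      (\<exists>u \<in> BUC 1 ({0..} \<times> UNIV).
         classical_solution f g (\<lambda>x. ubar + v0 x) u \<and>
         (\<forall>w. classical_solution f g (\<lambda>x. ubar + v0 x) w \<longrightarrow>
            (\<forall>t\<ge>0. \<forall>x. w (t, x) = u (t, x))) \<and>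
         (\<forall>t\<ge>0.
            Linfty_norm (\<lambda>x. u (t, x) - ubar)
              \<le> Linfty_norm v0 * ereal (C0 * exp (deriv g ubar * t)) \<and>
            Linfty_norm (deriv (\<lambda>x. u (t, x)))
              \<le> Linfty_norm (deriv v0) * ereal (C0 * exp (deriv g ubar * t)))))"
proof -
  note f = C_diff_2_derivatives[OF assms(1)] and g = C_diff_2_derivatives[OF assms(2)]
  have rate: "deriv g ubar = - (- deriv g ubar)" "0 < - deriv g ubar" using assms(4) by auto
  obtain \<epsilon> where \<epsilon>: "0 < \<epsilon>" and exist: "\<forall>v0\<in>BUC 1 UNIV. \<forall>k k'.
    (\<forall>y. \<bar>v0 y\<bar> \<le> k) \<longrightarrow> (\<forall>y. \<bar>deriv v0 y\<bar> \<le> k') \<longrightarrow> k \<le> \<epsilon> \<longrightarrow> k' \<le> \<epsilon> \<longrightarrow>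
    (\<exists>u ux. u \<in> BUC 1 ({0..} \<times> UNIV) \<and> ux \<in> BUC 0 ({0..} \<times> UNIV) \<and>
      classical_solution f g (\<lambda>x. ubar + v0 x) u \<and>
      (\<forall>t\<ge>0. \<forall>x. ((\<lambda>y. u (t, y)) has_real_derivative ux (t, x)) (at x) \<and>
        \<bar>u (t, x) - ubar\<bar> \<le> k * (C0 * exp (- (- deriv g ubar) * t)) \<and>
        \<bar>ux (t, x)\<bar> \<le> k' * (C0 * exp (- (- deriv g ubar) * t))))"
    using global_decaying_solution[OF f(1,2) g(1,2) assms(3) rate assms(5)] by (elim exE conjE)
  show ?thesis
  proof (intro exI[of _ \<epsilon>] conjI ballI impI \<epsilon>)
    fix v0 :: "real \<Rightarrow> real"
    assume v0: "v0 \<in> BUC 1 UNIV" and small: "W1infty_norm v0 \<le> ereal \<epsilon>"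
    have v0_cont: "continuous_on UNIV v0" "continuous_on UNIV (deriv v0)"
      using v0 unfolding One_nat_def BUC_Suc_real by (simp_all add: uniformly_continuous_imp_continuous)
    have "Linfty_norm v0 \<le> ereal \<epsilon>" "Linfty_norm (deriv v0) \<le> ereal \<epsilon>"
      using small by (simp_all add: W1infty_norm_def)
    then obtain k k' where k: "Linfty_norm v0 = ereal k" "k \<le> \<epsilon>" "\<And>x. \<bar>v0 x\<bar> \<le> k"
      and k': "Linfty_norm (deriv v0) = ereal k'" "k' \<le> \<epsilon>" "\<And>x. \<bar>deriv v0 x\<bar> \<le> k'"
      using Linfty_norm_real[OF v0_cont(1)] Linfty_norm_real[OF v0_cont(2)] by metis
    obtain u ux where u: "u \<in> BUC 1 ({0..} \<times> UNIV)" and ux: "ux \<in> BUC 0 ({0..} \<times> UNIV)"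
      and sol: "classical_solution f g (\<lambda>x. ubar + v0 x) u"
      and der: "\<And>t x. 0 \<le> t \<Longrightarrow> ((\<lambda>y. u (t, y)) has_real_derivative ux (t, x)) (at x)"
      and est: "\<And>t x. 0 \<le> t \<Longrightarrow> \<bar>u (t, x) - ubar\<bar> \<le> k * (C0 * exp (deriv g ubar * t))"
        "\<And>t x. 0 \<le> t \<Longrightarrow> \<bar>ux (t, x)\<bar> \<le> k' * (C0 * exp (deriv g ubar * t))"
      using exist[rule_format, OF v0 k(3) k'(3) k(2) k'(2)] unfolding minus_minus by blast
    have unique: "w (t, x) = u (t, x)"
      if "classical_solution f g (\<lambda>x. ubar + v0 x) w" "0 \<le> t" for w t x
      by (rule classical_solution_unique[OF f g(1) _ sol that(1) _ that(2)])
        (use u in \<open>simp_all add: DERIV_continuous_on[OF g(2)]\<close>)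
    have bounds: "Linfty_norm (\<lambda>x. u (t, x) - ubar) \<le> Linfty_norm v0 * ereal (C0 * exp (deriv g ubar * t))"
      "Linfty_norm (deriv (\<lambda>x. u (t, x))) \<le> Linfty_norm (deriv v0) * ereal (C0 * exp (deriv g ubar * t))"
      if t: "0 \<le> t" for t
    proof -
      have "Linfty_norm (\<lambda>x. u (t, x) - ubar) \<le> ereal (k * (C0 * exp (deriv g ubar * t)))"
        by (intro Linfty_norm_le est(1)[OF t] continuous_intros DERIV_continuous_on[OF der[OF t]])
      then show "Linfty_norm (\<lambda>x. u (t, x) - ubar) \<le> Linfty_norm v0 * ereal (C0 * exp (deriv g ubar * t))"
        by (simp add: k(1))
      have "continuous_on UNIV (\<lambda>x. ux (t, x))"
        by (rule continuous_on_compose2[OF uniformly_continuous_imp_continuous]) (use t ux in \<open>auto intro!: continuous_intros\<close>)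
      then have "Linfty_norm (\<lambda>x. ux (t, x)) \<le> ereal (k' * (C0 * exp (deriv g ubar * t)))"
        by (rule Linfty_norm_le) (rule est(2)[OF t])
      moreover have "deriv (\<lambda>x. u (t, x)) = (\<lambda>x. ux (t, x))"
        using DERIV_imp_deriv[OF der[OF t]] by blast
      ultimately show "Linfty_norm (deriv (\<lambda>x. u (t, x))) \<le>
          Linfty_norm (deriv v0) * ereal (C0 * exp (deriv g ubar * t))"
        by (simp add: k'(1))
    qed
    show "\<exists>u \<in> BUC 1 ({0..} \<times> UNIV).
         classical_solution f g (\<lambda>x. ubar + v0 x) u \<and>
         (\<forall>w. classical_solution f g (\<lambda>x. ubar + v0 x) w \<longrightarrow>
            (\<forall>t\<ge>0. \<forall>x. w (t, x) = u (t, x))) \<and>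
         (\<forall>t\<ge>0.
            Linfty_norm (\<lambda>x. u (t, x) - ubar)
              \<le> Linfty_norm v0 * ereal (C0 * exp (deriv g ubar * t)) \<and>
            Linfty_norm (deriv (\<lambda>x. u (t, x)))
              \<le> Linfty_norm (deriv v0) * ereal (C0 * exp (deriv g ubar * t)))"
      using u sol unique bounds by (intro bexI[of _ u]) blast+
  qed
qed

end
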